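(* Under Assumptions 1 and 2 (stated in the context), the closure of $\mathcal{K}_\beta$ in $\mathbb{R}^{m\times n}$ is $$\operatorname{cl}(\mathcal{K}_\beta)=\{K\in\mathcal{K}:\|\mathbf{T}_\infty(K)\|_{\mathcal{H}_\infty}\le\beta\}.$$
   Context: Let $A\in\mathbb{R}^{n\times n}$, $B\in\mathbb{R}^{n\times m}$, $B_w\in\mathbb{R}^{n\times n}$, $W:=B_wB_w^{\mathsf T}$. Let $Q_2\succeq0$, $R_2\succ0$, $Q_\infty\succ0$, $R_\infty\succ0$ be symmetric weight matrices and $\beta>0$. For $K\in\mathbb{R}^{m\times n}$ write $A_K:=A+BK$. Let $\mathcal{K}:=\{K: A_K \text{ Hurwitz}\}$. For $K\in\mathcal{K}$ let $\mathbf{T}_\infty(K)(s)=\begin{bmatrix}Q_\infty^{1/2}\\ R_\infty^{1/2}K\end{bmatrix}(sI-A_K)^{-1}B_w$ and $\|\cdot\|_{\mathcal{H}_\infty}$ the $\mathcal{H}_\infty$ norm. $\mathcal{K}_\beta:=\{K\in\mathcal{K}:\|\mathbf{T}_\infty(K)\|_{\mathcal{H}_\infty}<\beta\}$. Assumption 1: $(A,B)$ stabilizable, $(Q_2^{1/2},A)$ detectable, and $\beta>\beta^\ast:=\inf_{K\in\mathcal{K}}\|\mathbf{T}_\infty(K)\|_{\mathcal{H}_\infty}$. Assumption 2: $Q_2\succeq0$ and $W,Q_\infty,R_2,R_\infty$ positive definite. *)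

theory Defs
  imports "HOL-Analysis.Analysis"
begin

definition cmat :: "real^'n^'m \<Rightarrow> complex^'n^'m" where
  "cmat M = (\<chi> i j. complex_of_real (M $ i $ j))"

definition hurwitz :: "real^'n^'n \<Rightarrow> bool" where
  "hurwitz M \<longleftrightarrow> (\<forall>ev::complex. (\<exists>v::complex^'n. v \<noteq> 0 \<and> cmat M *v v = ev *s v) \<longrightarrow> Re ev < 0)"

definition sym_mat :: "real^'n^'n \<Rightarrow> bool" where
  "sym_mat M \<longleftrightarrow> transpose M = M"

definition psd :: "real^'n^'n \<Rightarrow> bool" where
  "psd M \<longleftrightarrow> sym_mat M \<and> (\<forall>x. 0 \<le> x \<bullet> (M *v x))"

definition pd :: "real^'n^'n \<Rightarrow> bool" where
  "pd M \<longleftrightarrow> sym_mat M \<and> (\<forall>x. x \<noteq> 0 \<longrightarrow> 0 < x \<bullet> (M *v x))"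

definition is_msqrt :: "real^'n^'n \<Rightarrow> real^'n^'n \<Rightarrow> bool" where
  "is_msqrt S M \<longleftrightarrow> psd S \<and> S ** S = M"

definition stabilizable :: "real^'n^'n \<Rightarrow> real^'m^'n \<Rightarrow> bool" where
  "stabilizable A B \<longleftrightarrow> (\<exists>K::real^'n^'m. hurwitz (A + B ** K))"

definition detectable :: "real^'n^'p \<Rightarrow> real^'n^'n \<Rightarrow> bool" where
  "detectable C A \<longleftrightarrow> (\<exists>L::real^'p^'n. hurwitz (A + L ** C))"

definition Tinf :: "real^'n^'n \<Rightarrow> real^'m^'n \<Rightarrow> real^'n^'n \<Rightarrow> real^'n^'n \<Rightarrow> real^'m^'m
    \<Rightarrow> real^'n^'m \<Rightarrow> complex \<Rightarrow> complex^'n^('n + 'm)" where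
  "Tinf A B Bw Qh Rh K s =
     (let G = matrix_inv (mat s - cmat (A + B ** K)) ** cmat Bw;
          C :: complex^'n^('n+'m) = (\<chi> i j. case i of Inl a \<Rightarrow> cmat Qh $ a $ j
                                                | Inr b \<Rightarrow> cmat (Rh ** K) $ b $ j)
      in C ** G)"

text \<open>H-infinity norm: supremum over the imaginary axis of the largest singular value
  (= induced Euclidean operator norm).\<close>
definition hinf_norm :: "real^'n^'n \<Rightarrow> real^'m^'n \<Rightarrow> real^'n^'n \<Rightarrow> real^'n^'n \<Rightarrow> real^'m^'m
    \<Rightarrow> real^'n^'m \<Rightarrow> real" where
  "hinf_norm A B Bw Qh Rh K =
     (SUP \<omega>::real. onorm (\<lambda>x::complex^'n. Tinf A B Bw Qh Rh K (\<i> * complex_of_real \<omega>) *v x))"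

end

(* By the bounded real lemma, K is stabilising with norm below \<gamma> iff some positive definite P solves the
   strict Riccati inequality; in the variables X = P^-1, Y = K X this inequality is convex.  Given K of
   norm at most \<beta> and K0 of norm below \<beta>, mix a solution for K at a level slightly above \<beta> with a
   solution for K0 at level \<beta>: for suitable weights the mixture is strictly feasible at level \<beta>, and
   as W is positive definite, |P x| is bounded by a multiple of |(A + B K) x|, so the resulting
   controllers converge to K.  The same bound on P keeps closed loop eigenvalues off the closed right
   half plane in the limit, which gives the other inclusion.

   The bounded real lemma comes from the Kalman-Yakubovich-Popov lemma, proved by separating a compact
   convex set from 0: a block matrix obstructing separation is deflated, one eigenvector at a time, into
   rank one pieces at imaginary frequencies. *)

theory Submission
  imports Defs "HOL-Computational_Algebra.Fundamental_Theorem_Algebra"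
begin

text \<open>Positive definiteness of W makes \<open>Bw\<close> invertible with inverse
  \<open>G\<close>, so the input is \<open>G\<close> applied to y - A x, with the state x and its
  derivative y free. All frequency conditions thereby become inequalities between real quadratic
  forms in x and y, and complex vectors are handled as pairs of real ones. In the separation, the
  dual object is a positive semidefinite block matrix with blocks P, S, R, and the equality
  constraint says that S is skew. Skewness forces the generalised eigenvalues of the pair (S, P)
  onto the imaginary axis, the only place where the frequency condition speaks. For the closure, the
  obstacle is that the solution for K at a level above \<beta> is not controlled as the level
  descends to \<beta>. Hence the weight t of K0 is fixed first, from the desired distance, and the
  level afterwards, in terms of t. This works because the solution for K cancels from the difference
  of the controllers: it is t times a matrix depending only on K, K0 and the solution for K0, times
  the new P.\<close>

declare transpose_matrix_vector [simp del]

section \<open>Rank one matrices and positive semidefinite matrices\<close>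

definition outer :: "real^'m \<Rightarrow> real^'n \<Rightarrow> real^'n^'m" where
  "outer x y = (\<chi> i j. x $ i * y $ j)"

lemma outer_mult_vec: "outer x y *v z = (y \<bullet> z) *\<^sub>R x"
  by (simp add: outer_def vec_eq_iff matrix_vector_mult_def inner_vec_def sum_distrib_left mult_ac)

text \<open>The inner product of matrices is the entrywise (Frobenius) one; this identity turns a
  separating functional on matrices into a bilinear form on vectors.\<close>

lemma inner_outer: "M \<bullet> outer x y = x \<bullet> (M *v y)"
  by (simp add: outer_def matrix_vector_mult_def inner_vec_def sum_distrib_left mult_ac)

lemma transpose_outer [simp]: "transpose (outer x y) = outer y x"
  by (simp add: outer_def transpose_def vec_eq_iff)

lemma matrix_mult_outer: "M ** outer x y = outer (M *v x) y"
  by (simp add: outer_def matrix_matrix_mult_def matrix_vector_mult_def vec_eq_iff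
      sum_distrib_right mult.assoc)

lemma outer_mult_transpose: "outer x y ** transpose M = outer x (M *v y)"
  by (simp add: outer_def matrix_matrix_mult_def matrix_vector_mult_def transpose_def vec_eq_iff
      sum_distrib_left mult_ac)

lemma trace_outer: "trace (outer x y) = x \<bullet> y"
  by (simp add: outer_def trace_def inner_vec_def)

lemma outer_scaleR_left: "outer (c *\<^sub>R x) y = c *\<^sub>R outer x y"
  and outer_scaleR_right: "outer x (c *\<^sub>R y) = c *\<^sub>R outer x y"
  and outer_zero_left [simp]: "outer 0 y = 0"
  and outer_zero_right [simp]: "outer x 0 = 0"
  by (simp_all add: outer_def vec_eq_iff algebra_simps)

lemma continuous_on_outer [continuous_intros]:
  assumes "continuous_on S f" "continuous_on S g"
  shows "continuous_on S (\<lambda>x. outer (f x) (g x))"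
  unfolding outer_def by (intro continuous_intros assms)

lemma continuous_on_matrix_vector [continuous_intros]:
  fixes M :: "real^'n^'m"
  assumes "continuous_on S f"
  shows "continuous_on S (\<lambda>x. M *v f x)"
  by (rule bounded_linear.continuous_on[OF matrix_vector_mul_bounded_linear assms])

lemma inner_matrix_transpose: "x \<bullet> (M *v y) = (transpose M *v x) \<bullet> y"
  for M :: "real^'n^'m"
  by (simp add: dot_lmul_matrix transpose_matrix_vector)

lemma sym_mat_inner: "sym_mat M \<Longrightarrow> x \<bullet> (M *v y) = (M *v x) \<bullet> y"
  by (metis inner_matrix_transpose sym_mat_def)

lemma transpose_add: "transpose (M + N) = transpose M + transpose N"
  and transpose_diff: "transpose (M - N) = transpose M - transpose N"
  and transpose_minus: "transpose (- M) = - transpose M"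
  for M N :: "real^'n^'m"
  by (simp_all add: transpose_def vec_eq_iff)

lemma scaleR_matrix_vector: "(c *\<^sub>R M) *v x = c *\<^sub>R (M *v x)" for M :: "real^'n^'m"
  by (simp add: scaleR_matrix_vector_assoc)

lemma psd_sym: "psd M \<Longrightarrow> sym_mat M"
  by (simp add: psd_def)

lemma psd_nonneg: "psd M \<Longrightarrow> 0 \<le> x \<bullet> (M *v x)"
  by (simp add: psd_def)

lemma pd_sym: "pd M \<Longrightarrow> sym_mat M"
  by (simp add: pd_def)

lemma pd_imp_psd: "pd M \<Longrightarrow> psd M"
  unfolding psd_def pd_def by (metis inner_zero_left less_eq_real_def)

lemma psd_zero: "psd 0"
  by (simp add: psd_def sym_mat_def transpose_def vec_eq_iff)

lemma psd_add: "psd M \<Longrightarrow> psd N \<Longrightarrow> psd (M + N)"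
  by (simp add: psd_def sym_mat_def transpose_add algebra_simps)

lemma psd_scaleR: "0 \<le> c \<Longrightarrow> psd M \<Longrightarrow> psd (c *\<^sub>R M)"
  by (simp add: psd_def sym_mat_def transpose_scalar scaleR_matrix_vector)

lemma psd_outer: "psd (outer x x)"
  by (simp add: psd_def sym_mat_def outer_mult_vec inner_commute)

lemma affine_nonneg_imp_zero:
  fixes u v :: real
  assumes "\<And>t. 0 \<le> t * u + v"
  shows "u = 0"
proof (rule ccontr)
  assume "u \<noteq> 0"
  with assms[of "- (v + 1) / u"] show False by simp
qed

text \<open>Along t x + M x the form has no term quadratic in t, and its slope is twice the squared
  norm of M x; a nonnegative affine function has slope zero.\<close>

lemma psd_kernel:
  assumes M: "psd M" and x: "x \<bullet> (M *v x) = 0"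
  shows "M *v x = 0"
proof -
  have "0 \<le> t * (2 * (norm (M *v x))\<^sup>2) + (M *v x) \<bullet> (M *v (M *v x))" for t
  proof -
    have "0 \<le> (t *\<^sub>R x + M *v x) \<bullet> (M *v (t *\<^sub>R x + M *v x))"
      using M by (rule psd_nonneg)
    also have "\<dots> = t * (2 * (norm (M *v x))\<^sup>2) + (M *v x) \<bullet> (M *v (M *v x))"
      using x sym_mat_inner[OF psd_sym[OF M], of x "M *v x"]
      by (simp add: algebra_simps power2_norm_eq_inner)
    finally show ?thesis .
  qed
  from affine_nonneg_imp_zero[OF this] show ?thesis by simp
qed

lemma matrix_entry_axis: "M $ i $ j = axis i 1 \<bullet> (M *v axis j 1)" for M :: "real^'n^'m"
  by (simp add: matrix_vector_mult_basis column_def inner_axis')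

lemma psd_trace_nonneg: "psd M \<Longrightarrow> 0 \<le> trace M"
  unfolding trace_def by (simp add: sum_nonneg matrix_entry_axis psd_nonneg)

lemma trace_scaleR: "trace (c *\<^sub>R M) = c * trace M" for M :: "real^'n^'n"
  by (simp add: trace_def sum_distrib_left)

text \<open>\<open>CARD('n)\<close> minus the dimension of the kernel is the rank; its strict
  decrease drives the deflation inductions below.\<close>

lemma dim_kernel_less:
  fixes M M' :: "real^'n^'m"
  assumes "\<And>x. M *v x = 0 \<Longrightarrow> M' *v x = 0" and "M' *v z = 0" "M *v z \<noteq> 0"
  shows "CARD('n) - dim {x. M' *v x = 0} < CARD('n) - dim {x. M *v x = 0}"
proof -
  have sub: "subspace {x. N *v x = 0}" for N :: "real^'n^'m"
    by (auto simp: subspace_def algebra_simps)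
  have "dim {x. M *v x = 0} < dim {x. M' *v x = 0}"
    using assms by (intro dim_psubset) (auto simp: span_eq_iff[THEN iffD2, OF sub])
  moreover have "dim {x. M' *v x = 0} \<le> CARD('n)"
    by (rule dim_subset_UNIV_cart)
  ultimately show ?thesis by simp
qed

text \<open>Rank reduction as in a Cholesky step: subtracting the outer square of
  \<open>M *v z\<close>, divided by \<open>z \<bullet> (M *v z)\<close>, keeps the matrix positive
  semidefinite and adds z to its kernel.\<close>

lemma psd_linear_functional_nonneg:
  fixes \<Phi> :: "real^'n^'n \<Rightarrow> real"
  assumes lin: "linear \<Phi>" and outer: "\<And>y. 0 \<le> \<Phi> (outer y y)" and "psd M"
  shows "0 \<le> \<Phi> M"
  using \<open>psd M\<close>
proof (induction "CARD('n) - dim {x. M *v x = 0}" arbitrary: M rule: less_induct)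
  case less
  show ?case
  proof (cases "M = 0")
    case True
    then show ?thesis by (simp add: linear_0[OF lin])
  next
    case False
    then obtain z where z: "M *v z \<noteq> 0"
      by (metis matrix_eq matrix_vector_mult_0)
    let ?v = "M *v z" and ?c = "z \<bullet> (M *v z)"
    have c: "?c > 0"
      using z psd_kernel[OF less.prems, of z] psd_nonneg[OF less.prems, of z]
      by (auto simp: less_le)
    define M' where "M' = M - (1 / ?c) *\<^sub>R outer ?v ?v"
    have M'v: "M' *v x = M *v x - ((?v \<bullet> x) / ?c) *\<^sub>R ?v" for x
      by (simp add: M'_def matrix_vector_mult_diff_rdistrib scaleR_matrix_vector outer_mult_vec)
    note sym = sym_mat_inner[OF psd_sym[OF less.prems]]
    have "psd M'"
      unfolding psd_def
    proof (intro conjI allI)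
      show "sym_mat M'"
        using psd_sym[OF less.prems]
        by (simp add: M'_def sym_mat_def transpose_diff transpose_scalar)
      fix x
      \<comment> \<open>\<open>?t\<close> minimises the form of \<open>M\<close> along x - t z, and
        the minimum is exactly the form of \<open>M'\<close> at x.\<close>
      let ?t = "(?v \<bullet> x) / ?c"
      have "0 \<le> (x - ?t *\<^sub>R z) \<bullet> (M *v (x - ?t *\<^sub>R z))"
        by (rule psd_nonneg[OF less.prems])
      also have "\<dots> = x \<bullet> (M *v x) - 2 * ?t * (?v \<bullet> x) + ?t\<^sup>2 * ?c"
        using sym[of z x] by (simp add: algebra_simps inner_commute power2_eq_square)
      also have "?t\<^sup>2 * ?c = ?t * (?v \<bullet> x)"
        using c by (simp add: power2_eq_square)
      finally show "0 \<le> x \<bullet> (M' *v x)"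
        by (simp add: M'v inner_diff_right inner_commute)
    qed
    moreover have "CARD('n) - dim {x. M' *v x = 0} < CARD('n) - dim {x. M *v x = 0}"
    proof (rule dim_kernel_less)
      show "M' *v x = 0" if "M *v x = 0" for x
        using that sym[of z x] by (simp add: M'v)
      show "M' *v z = 0"
        using c by (simp add: M'v inner_commute)
    qed (rule z)
    ultimately have "0 \<le> \<Phi> M'"
      using less.hyps by blast
    moreover have "\<Phi> M = \<Phi> M' + (1 / ?c) * \<Phi> (outer ?v ?v)"
      by (simp add: M'_def linear_diff[OF lin] linear_scale[OF lin])
    ultimately show ?thesis
      using outer[of ?v] c by simp
  qed
qed

subsection \<open>Real eigenpairs\<close>

definition poly_act :: "('a::real_vector \<Rightarrow> 'a) \<Rightarrow> real poly \<Rightarrow> 'a \<Rightarrow> 'a" where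
  "poly_act T p v = (\<Sum>i\<le>degree p. coeff p i *\<^sub>R (T ^^ i) v)"

lemma poly_act_altdef:
  "degree p \<le> n \<Longrightarrow> poly_act T p v = (\<Sum>i\<le>n. coeff p i *\<^sub>R (T ^^ i) v)"
  unfolding poly_act_def by (rule sum.mono_neutral_left) (auto simp: coeff_eq_0)

lemma poly_act_0 [simp]: "poly_act T 0 v = 0"
  by (simp add: poly_act_def)

lemma poly_act_add: "poly_act T (p + q) v = poly_act T p v + poly_act T q v"
  by (simp add: poly_act_altdef[of p "max (degree p) (degree q)"]
      poly_act_altdef[of q "max (degree p) (degree q)"]
      poly_act_altdef[of "p + q" "max (degree p) (degree q)"] degree_add_le_max
      algebra_simps sum.distrib)

lemma poly_act_smult: "poly_act T (smult c p) v = c *\<^sub>R poly_act T p v"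
  by (simp add: poly_act_altdef[of "smult c p" "degree p"] poly_act_def scaleR_sum_right
      degree_smult_le)

lemma poly_act_pCons:
  assumes "linear T"
  shows "poly_act T (pCons c p) v = c *\<^sub>R v + T (poly_act T p v)"
  by (subst poly_act_altdef[OF degree_pCons_le], subst sum.atMost_Suc_shift)
    (simp add: poly_act_def linear_sum[OF assms] linear_scale[OF assms])

lemma poly_act_mult:
  assumes "linear T"
  shows "poly_act T (p * q) v = poly_act T p (poly_act T q v)"
  by (induction p) (simp_all add: poly_act_add poly_act_smult poly_act_pCons assms)

lemma poly_act_in_subspace:
  assumes "subspace U" "\<And>x. x \<in> U \<Longrightarrow> T x \<in> U" "v \<in> U"
  shows "poly_act T p v \<in> U"
proof -
  have "(T ^^ i) v \<in> U" for i
    by (induction i) (use assms in auto)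
  then show ?thesis
    unfolding poly_act_def using assms(1) by (intro subspace_sum subspace_scale) auto
qed

text \<open>\<open>dependent\<close> speaks of sets, so a repetition among the iterates of v is
  treated separately and gives a difference of two monomials. Otherwise \<open>DIM('a)\<close> + 1
  distinct iterates satisfy a linear relation, whose coefficients form the polynomial.\<close>

lemma annihilating_poly_exists:
  fixes T :: "'a::euclidean_space \<Rightarrow> 'a"
  shows "\<exists>p. p \<noteq> 0 \<and> poly_act T p v = 0"
proof -
  let ?f = "\<lambda>i. (T ^^ i) v"
  show ?thesis
  proof (cases "inj_on ?f {..DIM('a)}")
    case False
    then obtain i j where ij: "i \<noteq> j" "?f i = ?f j"
      by (auto simp: inj_on_def)
    let ?p = "monom 1 i - monom 1 j :: real poly"
    have "poly_act T ?p v = (\<Sum>k\<le>max i j. coeff ?p k *\<^sub>R ?f k)"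
      by (intro poly_act_altdef degree_diff_le) (auto simp: degree_monom_eq)
    also have "\<dots> = (\<Sum>k\<le>max i j. (if k = i then ?f i else 0) - (if k = j then ?f j else 0))"
      by (intro sum.cong) auto
    also have "\<dots> = 0"
      using ij by (simp add: sum_subtractf)
    finally show ?thesis
      using ij by (intro exI[of _ ?p]) (simp add: monom_eq_iff')
  next
    case True
    have "card (?f ` {..DIM('a)}) > DIM('a)"
      using True by (simp add: card_image)
    then have "dependent (?f ` {..DIM('a)})"
      using dependent_biggerset by fastforce
    then obtain u where u: "(\<Sum>w\<in>?f ` {..DIM('a)}. u w *\<^sub>R w) = 0"
        "\<exists>w\<in>?f ` {..DIM('a)}. u w \<noteq> 0"
      by (auto simp: dependent_finite)
    let ?p = "\<Sum>k\<le>DIM('a). monom (u (?f k)) k"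
    have cf: "coeff ?p k = (if k \<le> DIM('a) then u (?f k) else 0)" for k
      by (simp add: coeff_sum)
    have "poly_act T ?p v = (\<Sum>k\<le>DIM('a). coeff ?p k *\<^sub>R ?f k)"
      by (intro poly_act_altdef degree_le) (simp add: cf)
    also have "\<dots> = (\<Sum>k\<le>DIM('a). u (?f k) *\<^sub>R ?f k)"
      by (intro sum.cong) (simp_all add: cf)
    also have "\<dots> = 0"
      using u(1) True by (simp add: sum.reindex)
    finally have "poly_act T ?p v = 0" .
    moreover have "?p \<noteq> 0"
      using u(2) cf by (metis (no_types, lifting) atMost_iff coeff_0 imageE)
    ultimately show ?thesis by blast
  qed
qed

lemma poly_map_of_real_add:
  "poly (map_poly complex_of_real (p + q)) z
    = poly (map_poly of_real p) z + poly (map_poly of_real q) z"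
proof -
  have "map_poly complex_of_real (p + q) = map_poly of_real p + map_poly of_real q"
    by (rule poly_eqI) (simp add: coeff_map_poly)
  then show ?thesis by simp
qed

lemma poly_map_of_real_mult:
  "poly (map_poly complex_of_real (p * q)) z
    = poly (map_poly of_real p) z * poly (map_poly of_real q) z"
  by (induction p)
    (simp_all add: poly_map_of_real_add map_poly_smult map_poly_pCons algebra_simps)

lemma poly_map_of_real_of_real:
  "poly (map_poly complex_of_real p) (of_real x) = of_real (poly p x)"
  by (induction p) (simp_all add: map_poly_pCons)

text \<open>The pair \<open>(a, b)\<close> is the real and imaginary part of a complex eigenvector for the eigenvalue
  \<open>\<alpha> + \<i> \<beta>\<close>.\<close>

lemma invariant_subspace_eigenpair:
  fixes T :: "'a::euclidean_space \<Rightarrow> 'a"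
  assumes lin: "linear T" and U: "subspace U" "\<And>x. x \<in> U \<Longrightarrow> T x \<in> U" "v \<in> U" and "v \<noteq> 0"
  obtains a b \<alpha> \<beta> where "a \<in> U" "b \<in> U" "a \<noteq> 0 \<or> b \<noteq> 0"
    "T a = \<alpha> *\<^sub>R a - \<beta> *\<^sub>R b" "T b = \<beta> *\<^sub>R a + \<alpha> *\<^sub>R b"
proof -
  let ?P = "\<lambda>p. p \<noteq> 0 \<and> poly_act T p v = 0"
  obtain p where p: "p \<noteq> 0" "poly_act T p v = 0"
    and minimal: "\<And>q. q \<noteq> 0 \<Longrightarrow> degree q < degree p \<Longrightarrow> poly_act T q v \<noteq> 0"
    using annihilating_poly_exists[of T v] ex_has_least_nat[of ?P _ degree]
    by (metis leD)
  \<comment> \<open>By minimality of p, cancelling a factor d of positive degree leaves a nonzero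
    vector r(T) v, which d(T) kills. With d the real minimal polynomial of a root \<mu>, this vector
    yields the eigenpair.\<close>
  have act_ne: "poly_act T r v \<noteq> 0" if "p = d * r" "degree d > 0" for d r
  proof (rule minimal)
    show "r \<noteq> 0" "degree r < degree p"
      using that p(1) by (auto simp: degree_mult_eq)
  qed
  have "degree p > 0"
  proof (rule ccontr)
    assume "\<not> degree p > 0"
    then obtain c where "p = [:c:]"
      by (meson degree_eq_zeroE neq0_conv)
    then show False
      using p \<open>v \<noteq> 0\<close> by (simp add: poly_act_pCons[OF lin] linear_0[OF lin])
  qed
  then have "degree (map_poly complex_of_real p) \<noteq> 0"
    by (simp add: degree_map_poly)
  then obtain \<mu> where \<mu>: "poly (map_poly complex_of_real p) \<mu> = 0"
    by (metis constant_degree fundamental_theorem_of_algebra)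
  show thesis
  proof (cases "Im \<mu> = 0")
    case True
    then have "\<mu> = of_real (Re \<mu>)"
      by (simp add: complex_eq_iff)
    then have "poly p (Re \<mu>) = 0"
      using \<mu> poly_map_of_real_of_real[of p "Re \<mu>"] by (metis of_real_eq_0_iff)
    then obtain r where r: "p = [:- Re \<mu>, 1:] * r"
      by (metis dvd_def poly_eq_0_iff_dvd)
    let ?u = "poly_act T r v"
    have "T ?u = Re \<mu> *\<^sub>R ?u"
      using p(2) unfolding r poly_act_mult[OF lin] by (simp add: poly_act_pCons[OF lin] linear_0[OF lin])
    moreover have "?u \<noteq> 0"
      using r by (rule act_ne) simp
    ultimately show ?thesis
      using that[of ?u 0 "Re \<mu>" 0] U poly_act_in_subspace[OF U]
      by (simp add: linear_0[OF lin] subspace_0)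
  next
    case False
    define \<alpha> \<beta> where "\<alpha> = Re \<mu>" and "\<beta> = Im \<mu>"
    \<comment> \<open>This is (X - \<mu>) times (X - conjugate of \<mu>). As \<mu> is not real, a
      real polynomial of degree below 2 that vanishes at \<mu> is zero, so the remainder of p modulo
      \<open>?d\<close> vanishes.\<close>
    let ?d = "[:\<alpha>\<^sup>2 + \<beta>\<^sup>2, - 2 * \<alpha>, 1:]"
    have d\<mu>: "poly (map_poly complex_of_real ?d) \<mu> = 0"
      by (simp add: map_poly_pCons complex_eq_iff \<alpha>_def \<beta>_def power2_eq_square algebra_simps)
    have "p mod ?d = 0"
    proof -
      have "degree (p mod ?d) < 2"
        using degree_mod_less[of ?d p] by auto
      then have "p mod ?d = [:coeff (p mod ?d) 0, coeff (p mod ?d) 1:]"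
        by (intro poly_eqI) (auto simp: coeff_pCons coeff_eq_0 split: nat.split)
      then obtain c0 c1 where c: "p mod ?d = [:c0, c1:]"
        by blast
      have "poly (map_poly complex_of_real (?d * (p div ?d) + p mod ?d)) \<mu> = 0"
        using \<mu> by (simp only: mult_div_mod_eq)
      then have "poly (map_poly complex_of_real (p mod ?d)) \<mu> = 0"
        by (simp only: poly_map_of_real_add poly_map_of_real_mult d\<mu> mult_zero_left add_0_left)
      then have "poly (map_poly complex_of_real [:c0, c1:]) \<mu> = 0"
        by (simp only: c)
      then have "c0 + c1 * \<alpha> = 0" "c1 * \<beta> = 0"
        by (simp_all add: map_poly_pCons complex_eq_iff \<alpha>_def \<beta>_def mult.commute)
      then show ?thesis
        using False unfolding c by (simp add: \<beta>_def)
    qed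
    then obtain r where r: "p = ?d * r"
      by (metis dvd_def mod_eq_0_iff_dvd)
    let ?u = "poly_act T r v"
    \<comment> \<open>With \<open>?u\<close> as the imaginary part b, the equation T b = \<beta> a +
      \<alpha> b dictates a.\<close>
    let ?a = "(1 / \<beta>) *\<^sub>R (T ?u - \<alpha> *\<^sub>R ?u)"
    have "poly_act T ?d ?u = 0"
      using p(2) unfolding r poly_act_mult[OF lin] .
    then have "(\<alpha>\<^sup>2 + \<beta>\<^sup>2) *\<^sub>R ?u + (- 2 * \<alpha>) *\<^sub>R T ?u + T (T ?u) = 0"
      by (simp add: poly_act_pCons[OF lin] linear_0[OF lin] linear_add[OF lin] linear_scale[OF lin]
          linear_diff[OF lin] algebra_simps del: scaleR_left_distrib)
    then have TTu: "T (T ?u) = (2 * \<alpha>) *\<^sub>R T ?u - (\<alpha>\<^sup>2 + \<beta>\<^sup>2) *\<^sub>R ?u"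
      by (simp add: algebra_simps add_eq_0_iff)
    have "T ?a = \<alpha> *\<^sub>R ?a - \<beta> *\<^sub>R ?u"
      using False unfolding linear_scale[OF lin] linear_diff[OF lin] TTu
      by (simp add: \<beta>_def[symmetric] power2_eq_square algebra_simps)
        (simp flip: scaleR_left_distrib add: field_simps)
    moreover have "T ?u = \<beta> *\<^sub>R ?a + \<alpha> *\<^sub>R ?u"
      using False by (simp add: \<beta>_def[symmetric])
    moreover have "?u \<noteq> 0"
      using r by (rule act_ne) simp
    moreover have "?u \<in> U" "?a \<in> U"
      using U poly_act_in_subspace[OF U] by (auto intro!: subspace_scale subspace_diff)
    ultimately show ?thesis
      using that by blast
  qed
qed

subsection \<open>Hurwitz matrices and Lyapunov's inequality\<close>

definition cvec :: "real^'n \<Rightarrow> real^'n \<Rightarrow> complex^'n" where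
  "cvec a b = (\<chi> i. Complex (a $ i) (b $ i))"

lemma cvec_exists: obtains a b where "v = cvec a b"
  by (rule that[of "\<chi> i. Re (v $ i)" "\<chi> i. Im (v $ i)"]) (simp add: cvec_def vec_eq_iff)

lemma cvec_eq_iff: "cvec a b = cvec c d \<longleftrightarrow> a = c \<and> b = d"
  by (auto simp: cvec_def vec_eq_iff)

lemma cvec_zero: "cvec 0 0 = 0"
  by (simp add: cvec_def vec_eq_iff complex_eq_iff)

lemma cvec_diff: "cvec a b - cvec c d = cvec (a - c) (b - d)"
  by (simp add: cvec_def vec_eq_iff complex_eq_iff)

lemma cmat_mult_cvec: "cmat M *v cvec a b = cvec (M *v a) (M *v b)"
  by (simp add: cmat_def cvec_def vec_eq_iff matrix_vector_mult_def complex_eq_iff)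

lemma smult_cvec: "z *s cvec a b = cvec (Re z *\<^sub>R a - Im z *\<^sub>R b) (Im z *\<^sub>R a + Re z *\<^sub>R b)"
  by (simp add: cvec_def vec_eq_iff complex_eq_iff)

lemma norm_cvec: "(norm (cvec a b))\<^sup>2 = (norm a)\<^sup>2 + (norm b)\<^sup>2"
  by (simp add: norm_vec_def L2_set_def cvec_def sum_nonneg cmod_def sum.distrib)

text \<open>Eigenvectors are split as a + i b and eigenvalues as \<alpha> + i \<beta>, which lets
  the stability arguments work with real vectors and real symmetric forms.\<close>

lemma hurwitz_iff_eigenpair:
  "hurwitz M \<longleftrightarrow> (\<forall>a b \<alpha> \<beta>. (a \<noteq> 0 \<or> b \<noteq> 0) \<and> M *v a = \<alpha> *\<^sub>R a - \<beta> *\<^sub>R b \<and>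
      M *v b = \<beta> *\<^sub>R a + \<alpha> *\<^sub>R b \<longrightarrow> \<alpha> < 0)"
proof
  assume M: "hurwitz M"
  show "\<forall>a b \<alpha> \<beta>. (a \<noteq> 0 \<or> b \<noteq> 0) \<and> M *v a = \<alpha> *\<^sub>R a - \<beta> *\<^sub>R b \<and>
      M *v b = \<beta> *\<^sub>R a + \<alpha> *\<^sub>R b \<longrightarrow> \<alpha> < 0"
  proof (intro allI impI)
    fix a b \<alpha> \<beta>
    assume *: "(a \<noteq> 0 \<or> b \<noteq> 0) \<and> M *v a = \<alpha> *\<^sub>R a - \<beta> *\<^sub>R b \<and> M *v b = \<beta> *\<^sub>R a + \<alpha> *\<^sub>R b"
    have "cvec a b \<noteq> 0"
      using * by (metis cvec_eq_iff cvec_zero)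
    moreover have "cmat M *v cvec a b = Complex \<alpha> \<beta> *s cvec a b"
      using * by (simp add: cmat_mult_cvec smult_cvec)
    ultimately have "Re (Complex \<alpha> \<beta>) < 0"
      using M unfolding hurwitz_def by blast
    then show "\<alpha> < 0" by simp
  qed
next
  assume R: "\<forall>a b \<alpha> \<beta>. (a \<noteq> 0 \<or> b \<noteq> 0) \<and> M *v a = \<alpha> *\<^sub>R a - \<beta> *\<^sub>R b \<and>
      M *v b = \<beta> *\<^sub>R a + \<alpha> *\<^sub>R b \<longrightarrow> \<alpha> < 0"
  show "hurwitz M"
    unfolding hurwitz_def
  proof (intro allI impI, elim exE conjE)
    fix ev v
    assume v: "v \<noteq> 0" "cmat M *v v = ev *s v"
    obtain a b where ab: "v = cvec a b"
      by (rule cvec_exists)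
    have "a \<noteq> 0 \<or> b \<noteq> 0"
      using v(1) ab cvec_zero by auto
    moreover have "M *v a = Re ev *\<^sub>R a - Im ev *\<^sub>R b" "M *v b = Im ev *\<^sub>R a + Re ev *\<^sub>R b"
      using v(2) by (simp_all add: ab cmat_mult_cvec smult_cvec cvec_eq_iff)
    ultimately show "Re ev < 0"
      using R by blast
  qed
qed

text \<open>The convex hull of S is compact and so strictly separable from 0. \<open>G\<close> only
  certifies that the hull avoids 0; in the applications it is the image of a convex set of positive
  semidefinite matrices, for which closedness would be awkward to show.\<close>

lemma compact_separation:
  fixes S :: "'a::euclidean_space set"
  assumes "compact S" "S \<subseteq> G" "convex G" "0 \<notin> G"
  shows "\<exists>a. \<forall>x\<in>S. 0 < a \<bullet> x"
proof -
  have "0 \<notin> convex hull S"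
    using assms hull_minimal[of S G convex] by blast
  with separating_hyperplane_closed_0[of "convex hull S"] assms(1)
  obtain a b where "0 < b" "\<forall>x\<in>convex hull S. b < a \<bullet> x"
    by (auto simp: compact_convex_hull compact_imp_closed)
  then show ?thesis
    by (meson hull_inc less_trans)
qed

lemma scaleR_matrix_mult: "(c *\<^sub>R M) ** N = c *\<^sub>R (M ** N)"
  and matrix_mult_scaleR: "M ** (c *\<^sub>R N) = c *\<^sub>R (M ** N)"
  and matrix_mult_add_left: "(M + M') ** N = M ** N + M' ** N"
  for M :: "real^'n^'m" and N :: "real^'p^'n"
  by (simp_all add: vec_eq_iff matrix_matrix_mult_def sum_distrib_left sum.distrib algebra_simps)

text \<open>By symmetry the component k of y orthogonal to the range satisfies P k = 0; it is then
  orthogonal to y, hence to itself.\<close>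

lemma sym_mat_range:
  assumes P: "sym_mat P" and y: "\<And>k. P *v k = 0 \<Longrightarrow> k \<bullet> y = 0"
  shows "y \<in> range ((*v) P)"
proof -
  have span: "span (range ((*v) P)) = range ((*v) P)"
    by (simp add: linear_subspace_image span_eq_iff)
  obtain u k where u: "u \<in> span (range ((*v) P))"
    and k: "\<And>w. w \<in> span (range ((*v) P)) \<Longrightarrow> orthogonal k w" and yuk: "y = u + k"
    using orthogonal_subspace_decomp_exists[of "range ((*v) P)" y] by blast
  have "(P *v k) \<bullet> (P *v k) = k \<bullet> (P *v (P *v k))"
    by (simp add: sym_mat_inner[OF P])
  also have "\<dots> = 0"
    using k[of "P *v (P *v k)"] by (simp add: span orthogonal_def)
  finally have "k \<bullet> y = 0"
    using y by simp
  then have "k = 0"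
    using k[OF u] by (simp add: yuk orthogonal_def inner_add_right)
  then show ?thesis
    using u yuk span by simp
qed

lemma convex_comb_pos:
  fixes u v s t :: real
  assumes "0 \<le> u" "0 \<le> v" "u + v = 1" "0 < s" "0 < t"
  shows "0 < u * s + v * t"
  using assms by (metis add_nonneg_pos add_pos_nonneg add_0 less_eq_real_def mult_nonneg_nonneg
      mult_pos_pos zero_neq_one)

text \<open>A theorem of alternatives. A functional M separating \<open>?S\<close> from 0 gives P as
  M + transpose M. If 0 were in \<open>G\<close>, there would be Z A^T + A Z = Y with both Z and Y
  positive semidefinite and Z nonzero; the range of Z is then invariant under A, and an eigenvalue
  of A on it has nonnegative real part.\<close>

lemma lyapunov_exists:
  assumes A: "hurwitz A"
  shows "\<exists>P. pd P \<and> (\<forall>x. x \<noteq> 0 \<longrightarrow> (P *v x) \<bullet> (A *v x) < 0)"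
proof -
  define L where "L Z = Z ** transpose A + A ** Z" for Z
  \<comment> \<open>The trace condition is a convex way to exclude Z = Y = 0.\<close>
  define G where "G = {Y - L Z |Z Y. psd Z \<and> psd Y \<and> 0 < trace Z + trace Y}"
  let ?l = "\<lambda>x. outer x (A *v x) + outer (A *v x) x"
  let ?S = "(\<lambda>z. outer z z) ` sphere 0 1 \<union> (\<lambda>x. - ?l x) ` sphere 0 1"
  have L_outer: "L (outer x x) = ?l x" for x
    by (simp add: L_def matrix_mult_outer outer_mult_transpose)
  have L0: "L 0 = 0"
    by (simp add: L_def vec_eq_iff matrix_matrix_mult_def)
  have L_lin: "L (u *\<^sub>R Z + v *\<^sub>R Z') = u *\<^sub>R L Z + v *\<^sub>R L Z'" for u v Z Z'
    by (simp add: L_def scaleR_matrix_mult matrix_mult_scaleR matrix_mult_add_left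
        matrix_add_ldistrib algebra_simps)
  have "compact ?S"
    by (intro compact_Un compact_continuous_image continuous_intros compact_sphere)
  moreover have "?S \<subseteq> G"
  proof -
    have "outer z z \<in> G" if "norm z = 1" for z
      unfolding G_def using that
      by (intro CollectI exI[of _ 0] exI[of _ "outer z z"])
        (simp add: L0 psd_zero psd_outer trace_outer dot_square_norm trace_def[of 0])
    moreover have "- ?l z \<in> G" if "norm z = 1" for z
      unfolding G_def using that
      by (intro CollectI exI[of _ "outer z z"] exI[of _ 0])
        (simp add: L_outer psd_zero psd_outer trace_outer dot_square_norm trace_def[of 0])
    ultimately show ?thesis by auto
  qed
  moreover have "convex G"
  proof (rule convexI)
    fix g g' and u v :: real
    assume "g \<in> G" "g' \<in> G" and uv: "0 \<le> u" "0 \<le> v" "u + v = 1"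
    then obtain Z Y Z' Y' where
      g: "g = Y - L Z" "psd Z" "psd Y" "0 < trace Z + trace Y" and
      g': "g' = Y' - L Z'" "psd Z'" "psd Y'" "0 < trace Z' + trace Y'"
      by (auto simp: G_def)
    have "u *\<^sub>R g + v *\<^sub>R g' = (u *\<^sub>R Y + v *\<^sub>R Y') - L (u *\<^sub>R Z + v *\<^sub>R Z')"
      by (simp add: L_lin g g' algebra_simps)
    moreover have "0 < trace (u *\<^sub>R Z + v *\<^sub>R Z') + trace (u *\<^sub>R Y + v *\<^sub>R Y')"
      using convex_comb_pos[OF uv g(4) g'(4)] by (simp add: trace_add trace_scaleR algebra_simps)
    ultimately show "u *\<^sub>R g + v *\<^sub>R g' \<in> G"
      unfolding G_def using g g' uv by (blast intro: psd_add psd_scaleR)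
  qed
  moreover have "0 \<notin> G"
  proof
    assume "0 \<in> G"
    then obtain Z Y where Y: "Y = L Z" and psd: "psd Z" "psd Y" and tr: "0 < trace Z + trace Y"
      by (auto simp: G_def)
    note sym = sym_mat_inner[OF psd_sym[OF psd(1)]]
    have YZ: "Y *v x = Z *v (transpose A *v x) + A *v (Z *v x)" for x
      by (simp add: Y L_def matrix_vector_mult_add_rdistrib matrix_vector_mul_assoc)
    have quad: "x \<bullet> (Y *v x) = 2 * (x \<bullet> (A *v (Z *v x)))" for x
      by (simp add: YZ inner_add_right sym inner_matrix_transpose[of x A] inner_commute)
    have kerY: "Y *v k = 0" if "Z *v k = 0" for k
      using that quad[of k] by (intro psd_kernel[OF psd(2)]) simp
    have "Z \<noteq> 0"
      using tr Y L0 by (auto simp: trace_def)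
    then obtain v where v: "Z *v v \<noteq> 0"
      by (metis matrix_eq matrix_vector_mult_0)
    \<comment> \<open>The kernel of Z lies in that of Y, so for k in it both terms of k . (A Z w) =
      k . (Y w) - k . (Z A^T w) vanish; thus A Z w is orthogonal to the kernel of Z.\<close>
    have inv: "A *v x \<in> range ((*v) Z)" if x: "x \<in> range ((*v) Z)" for x
    proof (rule sym_mat_range[OF psd_sym[OF psd(1)]])
      fix k assume k: "Z *v k = 0"
      obtain w where w: "x = Z *v w" using x by auto
      have "k \<bullet> (A *v x) = k \<bullet> (Y *v w) - k \<bullet> (Z *v (transpose A *v w))"
        by (simp add: YZ w inner_add_right)
      also have "\<dots> = 0"
        using k kerY[OF k] sym_mat_inner[OF psd_sym[OF psd(2)], of k w] sym[of k] by simp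
      finally show "k \<bullet> (A *v x) = 0" .
    qed
    obtain a b \<alpha> \<beta> where ab: "a \<in> range ((*v) Z)" "b \<in> range ((*v) Z)" "a \<noteq> 0 \<or> b \<noteq> 0"
      and eig: "A *v a = \<alpha> *\<^sub>R a - \<beta> *\<^sub>R b" "A *v b = \<beta> *\<^sub>R a + \<alpha> *\<^sub>R b"
      using invariant_subspace_eigenpair[OF matrix_vector_mul_linear
          linear_subspace_image[OF matrix_vector_mul_linear subspace_UNIV] inv rangeI[of "(*v) Z" v] v]
      by blast
    obtain p q where pq: "a = Z *v p" "b = Z *v q"
      using ab by auto
    \<comment> \<open>In the sum over p and q the terms with \<beta> cancel by symmetry of
      Z.\<close>
    have "0 \<le> p \<bullet> (Y *v p) + q \<bullet> (Y *v q)"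
      by (simp add: psd psd_nonneg)
    also have "\<dots> = 2 * \<alpha> * (p \<bullet> (Z *v p) + q \<bullet> (Z *v q))"
      using sym[of p q] unfolding quad pq[symmetric] eig
      by (simp add: pq algebra_simps inner_commute)
    finally have "0 \<le> \<alpha> * (p \<bullet> (Z *v p) + q \<bullet> (Z *v q))"
      by simp
    moreover have "p \<bullet> (Z *v p) + q \<bullet> (Z *v q) > 0"
    proof -
      have "p \<bullet> (Z *v p) \<noteq> 0 \<or> q \<bullet> (Z *v q) \<noteq> 0"
        using ab(3) pq psd_kernel[OF psd(1)] by metis
      then show ?thesis
        using psd_nonneg[OF psd(1), of p] psd_nonneg[OF psd(1), of q] by linarith
    qed
    ultimately have "0 \<le> \<alpha>"
      by (simp add: zero_le_mult_iff)
    moreover have "\<alpha> < 0"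
      using A ab(3) eig unfolding hurwitz_iff_eigenpair by blast
    ultimately show False by simp
  qed
  ultimately obtain M where M: "\<forall>s\<in>?S. 0 < M \<bullet> s"
    using compact_separation by blast
  let ?P = "M + transpose M"
  have P: "x \<bullet> (?P *v y) = x \<bullet> (M *v y) + y \<bullet> (M *v x)" for x y
    by (simp add: matrix_vector_mult_add_rdistrib inner_add_right inner_matrix_transpose[of x "transpose M"]
        inner_commute)
  have "sym_mat ?P"
    by (simp add: sym_mat_def transpose_add add.commute)
  have unit: "x \<bullet> (?P *v x) > 0 \<and> x \<bullet> (?P *v (A *v x)) < 0" if "norm x = 1" for x
  proof -
    have "0 < M \<bullet> outer x x" "0 < M \<bullet> (- ?l x)"
      using M that by auto
    then show ?thesis
      unfolding inner_minus_right by (simp add: inner_outer inner_add_right P)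
  qed
  have "x \<bullet> (?P *v x) > 0 \<and> x \<bullet> (?P *v (A *v x)) < 0" if "x \<noteq> 0" for x
  proof -
    let ?u = "(1 / norm x) *\<^sub>R x"
    have x: "x = norm x *\<^sub>R ?u" and "norm ?u = 1"
      using that by simp_all
    have "x \<bullet> (?P *v x) = norm x * (norm x * (?u \<bullet> (?P *v ?u)))"
      "x \<bullet> (?P *v (A *v x)) = norm x * (norm x * (?u \<bullet> (?P *v (A *v ?u))))"
      using that by (simp_all add: matrix_vector_mult_scaleR)
    with unit[OF \<open>norm ?u = 1\<close>] that show ?thesis
      by (simp add: mult_less_0_iff zero_less_mult_iff divide_less_0_iff zero_less_divide_iff)
  qed
  then show ?thesis
    using \<open>sym_mat ?P\<close> sym_mat_inner[OF \<open>sym_mat ?P\<close>]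
    by (intro exI[of _ ?P]) (simp add: pd_def)
qed

text \<open>P is compared with a Lyapunov solution Q. If the least ratio m0 of the two forms were
  not positive, P - m0 Q would be positive semidefinite with the minimiser m in its kernel; then P m
  = m0 Q m makes \<open>(P *v m) \<bullet> (A *v m)\<close> nonnegative.\<close>

lemma pd_if_lyapunov:
  fixes A :: "real^'n^'n"
  assumes A: "hurwitz A" and P: "sym_mat P" and neg: "\<And>x. x \<noteq> 0 \<Longrightarrow> (P *v x) \<bullet> (A *v x) < 0"
  shows "pd P"
proof -
  obtain Q where Q: "pd Q" and Qneg: "\<And>x. x \<noteq> 0 \<Longrightarrow> (Q *v x) \<bullet> (A *v x) < 0"
    using lyapunov_exists[OF A] by blast
  have Qpos: "x \<bullet> (Q *v x) > 0" if "x \<noteq> 0" for x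
    using Q that by (simp add: pd_def)
  let ?f = "\<lambda>x. (x \<bullet> (P *v x)) / (x \<bullet> (Q *v x))"
  have "\<exists>m\<in>sphere 0 1. \<forall>x\<in>sphere 0 1. ?f m \<le> ?f x"
  proof (rule continuous_attains_inf)
    show "sphere 0 1 \<noteq> ({} :: (real^'n) set)"
      by (simp add: sphere_eq_empty)
    show "continuous_on (sphere 0 1) ?f"
    proof (intro continuous_intros ballI)
      fix x :: "real^'n" assume "x \<in> sphere 0 1"
      then have "x \<noteq> 0" by auto
      then show "x \<bullet> (Q *v x) \<noteq> 0" using Qpos by (metis less_irrefl)
    qed
  qed simp
  then obtain m where m: "norm m = 1" and min: "\<And>x. norm x = 1 \<Longrightarrow> ?f m \<le> ?f x"
    by auto
  define m0 where "m0 = ?f m"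
  have "m \<noteq> 0" using m by auto
  have ge: "m0 * (x \<bullet> (Q *v x)) \<le> x \<bullet> (P *v x)" for x
  proof (cases "x = 0")
    case False
    let ?u = "(1 / norm x) *\<^sub>R x"
    have "norm ?u = 1" using False by simp
    from min[OF this] have "m0 \<le> ?f x"
      using False by (simp add: m0_def matrix_vector_mult_scaleR)
    then show ?thesis
      using Qpos[OF False] by (simp add: pos_le_divide_eq)
  qed simp
  have "m0 > 0"
  proof (rule ccontr)
    assume "\<not> m0 > 0"
    have "psd (P - m0 *\<^sub>R Q)"
      using ge P pd_sym[OF Q]
      by (simp add: psd_def sym_mat_def transpose_diff transpose_scalar
          matrix_vector_mult_diff_rdistrib scaleR_matrix_vector inner_diff_right)
    moreover have "m \<bullet> ((P - m0 *\<^sub>R Q) *v m) = 0"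
      using Qpos[OF \<open>m \<noteq> 0\<close>]
      by (simp add: m0_def matrix_vector_mult_diff_rdistrib scaleR_matrix_vector inner_diff_right)
    ultimately have "P *v m = m0 *\<^sub>R (Q *v m)"
      using psd_kernel by (fastforce simp: matrix_vector_mult_diff_rdistrib scaleR_matrix_vector)
    then have "(P *v m) \<bullet> (A *v m) = m0 * ((Q *v m) \<bullet> (A *v m))"
      by simp
    also have "\<dots> \<ge> 0"
      using Qneg[OF \<open>m \<noteq> 0\<close>] \<open>\<not> m0 > 0\<close> by (simp add: zero_le_mult_iff)
    finally show False
      using neg[OF \<open>m \<noteq> 0\<close>] by simp
  qed
  then show ?thesis
    using P ge Qpos by (simp add: pd_def) (meson less_le_trans mult_pos_pos)
qed

subsection \<open>A strict Kalman--Yakubovich--Popov lemma\<close>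

text \<open>The symmetric block matrix with rows (P, S^T) and (S, R), encoded by its quadratic form
  so that all blocks keep the index type \<open>'n\<close>.\<close>

definition psd_block :: "real^'n^'n \<Rightarrow> real^'n^'n \<Rightarrow> real^'n^'n \<Rightarrow> bool" where
  "psd_block P S R \<longleftrightarrow> sym_mat P \<and> sym_mat R \<and>
     (\<forall>x y. 0 \<le> x \<bullet> (P *v x) + 2 * (y \<bullet> (S *v x)) + y \<bullet> (R *v y))"

lemma minus_matrix_vector: "(- M) *v x = - (M *v x)" for M :: "real^'n^'m"
  using matrix_vector_mult_diff_rdistrib[of 0 M x] by simp

lemma psd_blockD:
  assumes "psd_block P S R"
  shows "psd P" "psd R"
proof -
  have "0 \<le> x \<bullet> (P *v x) + 2 * (y \<bullet> (S *v x)) + y \<bullet> (R *v y)" for x y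
    using assms by (simp add: psd_block_def)
  from this[of _ 0] this[of 0] show "psd P" "psd R"
    using assms by (simp_all add: psd_def psd_block_def)
qed

text \<open>The perturbation of \<open>psd_kernel\<close> at the stacked vector (t x, S x); P x = 0
  removes the term quadratic in t.\<close>

lemma psd_block_kernel:
  assumes Z: "psd_block P S R" and x: "P *v x = 0"
  shows "S *v x = 0"
proof -
  have "0 \<le> t * (2 * (norm (S *v x))\<^sup>2) + (S *v x) \<bullet> (R *v (S *v x))" for t
  proof -
    have "0 \<le> (t *\<^sub>R x) \<bullet> (P *v (t *\<^sub>R x)) + 2 * ((S *v x) \<bullet> (S *v (t *\<^sub>R x)))
        + (S *v x) \<bullet> (R *v (S *v x))"
      using Z unfolding psd_block_def by blast
    then show ?thesis
      by (simp add: matrix_vector_mult_scaleR x power2_norm_eq_inner mult_ac)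
  qed
  from affine_nonneg_imp_zero[OF this] show ?thesis by simp
qed

lemma psd_block_outer: "psd_block (outer x x) (outer y x) (outer y y)"
proof -
  have "0 \<le> (x \<bullet> u + y \<bullet> v)\<^sup>2" for u v by simp
  also have "(x \<bullet> u + y \<bullet> v)\<^sup>2 = u \<bullet> (outer x x *v u) + 2 * (v \<bullet> (outer y x *v u)) + v \<bullet> (outer y y *v v)" for u v
    by (simp add: outer_mult_vec power2_eq_square algebra_simps inner_commute)
  finally show ?thesis
    by (simp add: psd_block_def sym_mat_def)
qed

lemma psd_block_comb:
  assumes "psd_block P S R" "psd_block P' S' R'" "0 \<le> u" "0 \<le> v"
  shows "psd_block (u *\<^sub>R P + v *\<^sub>R P') (u *\<^sub>R S + v *\<^sub>R S') (u *\<^sub>R R + v *\<^sub>R R')"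
  unfolding psd_block_def
proof (intro conjI allI)
  show "sym_mat (u *\<^sub>R P + v *\<^sub>R P')" "sym_mat (u *\<^sub>R R + v *\<^sub>R R')"
    using assms by (simp_all add: psd_block_def sym_mat_def transpose_add transpose_scalar)
  fix x y
  have "0 \<le> u * (x \<bullet> (P *v x) + 2 * (y \<bullet> (S *v x)) + y \<bullet> (R *v y))
      + v * (x \<bullet> (P' *v x) + 2 * (y \<bullet> (S' *v x)) + y \<bullet> (R' *v y))"
    using assms unfolding psd_block_def by simp
  then show "0 \<le> x \<bullet> ((u *\<^sub>R P + v *\<^sub>R P') *v x) + 2 * (y \<bullet> ((u *\<^sub>R S + v *\<^sub>R S') *v x))
      + y \<bullet> ((u *\<^sub>R R + v *\<^sub>R R') *v y)"
    by (simp add: matrix_vector_mult_add_rdistrib scaleR_matrix_vector inner_add_right algebra_simps)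
qed

text \<open>The vector \<open>p + \<i> q\<close> solves the generalised eigenvalue problem \<open>S z = \<i> \<omega> P z\<close>; for \<open>\<omega> = 0\<close>
  a real solution is chosen, so that \<open>q = 0\<close>.\<close>

lemma psd_block_eigenpair:
  fixes P S R :: "real^'n^'n"
  assumes Z: "psd_block P S R" and skew: "transpose S = - S" and "P \<noteq> 0"
  obtains p q \<omega> where "S *v p = - \<omega> *\<^sub>R (P *v q)" "S *v q = \<omega> *\<^sub>R (P *v p)"
    "p \<bullet> (P *v p) > 0" "q \<bullet> (P *v q) \<le> p \<bullet> (P *v p)" "q \<bullet> (P *v p) = 0"
proof -
  note eigen = that
  note P = psd_blockD(1)[OF Z]
  note sym = sym_mat_inner[OF psd_sym[OF P]]
  let ?U = "range ((*v) P)"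
  have U: "subspace ?U"
    by (simp add: linear_subspace_image)
  have skew': "x \<bullet> (S *v y) = - (y \<bullet> (S *v x))" for x y
    using inner_matrix_transpose[of x S y] skew
    by (simp add: minus_matrix_vector inner_commute)
  have S_range: "S *v x \<in> ?U" for x
  proof (rule sym_mat_range[OF psd_sym[OF P]])
    show "k \<bullet> (S *v x) = 0" if "P *v k = 0" for k
      using psd_block_kernel[OF Z that] skew'[of k x] by simp
  qed
  have "inj_on ((*v) P) ?U"
  proof (rule inj_onI)
    fix x y assume "x \<in> ?U" "y \<in> ?U" and eq: "P *v x = P *v y"
    then obtain z where z: "x - y = P *v z"
      using subspace_diff[OF U] by blast
    have "(x - y) \<bullet> (x - y) = z \<bullet> (P *v (x - y))"
      by (simp add: sym z)
    then show "x = y"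
      using eq by (simp add: matrix_vector_mult_diff_distrib)
  qed
  then obtain g where g: "linear g" "\<And>x. x \<in> ?U \<Longrightarrow> g (P *v x) = x"
    using linear_exists_left_inverse_on[OF matrix_vector_mul_linear U] by blast
  \<comment> \<open>A symmetric P is injective on its range and g inverts it there, so T acts as S
    times a pseudoinverse of P: its eigenvectors in the range of P are the images P z of generalised
    eigenvectors z.\<close>
  define T where "T x = S *v g x" for x
  have TP: "T (P *v x) = S *v x" for x
  proof -
    have "P *v x \<in> (*v) P ` ?U"
    proof -
      obtain u k where u: "u \<in> span ?U" and k: "\<And>w. w \<in> span ?U \<Longrightarrow> orthogonal k w" and x: "x = u + k"
        using orthogonal_subspace_decomp_exists[of ?U x] by blast
      have "(P *v k) \<bullet> (P *v k) = k \<bullet> (P *v (P *v k))"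
        by (simp add: sym)
      also have "\<dots> = 0"
        using k[of "P *v (P *v k)"] by (simp add: span_base orthogonal_def)
      finally have "P *v x = P *v u"
        by (simp add: x matrix_vector_right_distrib)
      then show ?thesis
        using u U by (metis imageI span_eq_iff)
    qed
    then obtain u where u: "u \<in> ?U" "P *v x = P *v u" by auto
    then have "P *v (x - u) = 0"
      by (simp add: matrix_vector_mult_diff_distrib)
    then have "S *v x = S *v u"
      using psd_block_kernel[OF Z, of "x - u"] by (simp add: matrix_vector_mult_diff_distrib)
    then show ?thesis
      by (simp add: T_def u g(2))
  qed
  have "linear T"
    unfolding T_def using linear_compose[OF g(1) matrix_vector_mul_linear[of S]] by (simp add: o_def)
  moreover obtain v where "P *v v \<noteq> 0"
    using \<open>P \<noteq> 0\<close> by (metis matrix_eq matrix_vector_mult_0)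
  ultimately obtain a b \<alpha> \<beta> where ab: "a \<in> ?U" "b \<in> ?U" "a \<noteq> 0 \<or> b \<noteq> 0"
    and eig: "T a = \<alpha> *\<^sub>R a - \<beta> *\<^sub>R b" "T b = \<beta> *\<^sub>R a + \<alpha> *\<^sub>R b"
    using invariant_subspace_eigenpair[OF _ U _ rangeI[of "(*v) P" v], of T] S_range
    unfolding T_def by blast
  obtain p q where pq: "a = P *v p" "b = P *v q"
    using ab by auto
  have Sp: "S *v p = \<alpha> *\<^sub>R (P *v p) - \<beta> *\<^sub>R (P *v q)" and Sq: "S *v q = \<beta> *\<^sub>R (P *v p) + \<alpha> *\<^sub>R (P *v q)"
    using eig by (simp_all add: pq TP)
  have ne: "P *v p \<noteq> 0 \<or> P *v q \<noteq> 0"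
    using ab pq by simp
  have pos: "x \<bullet> (P *v x) > 0" if "P *v x \<noteq> 0" for x
    using that psd_kernel[OF P, of x] psd_nonneg[OF P, of x] by (auto simp: less_le)
  have pSp: "p \<bullet> (S *v p) = 0" "q \<bullet> (S *v q) = 0"
    using skew'[of p p] skew'[of q q] by simp_all
  have pPq: "p \<bullet> (P *v q) = q \<bullet> (P *v p)"
    by (simp add: sym[of p] inner_commute)
  \<comment> \<open>Skewness gives p . S p = q . S q = 0; in the sum of the two the terms with
    \<beta> cancel.\<close>
  have "\<alpha> * (p \<bullet> (P *v p) + q \<bullet> (P *v q)) = 0"
    using pSp pPq unfolding Sp Sq by (simp add: algebra_simps)
  moreover have "p \<bullet> (P *v p) + q \<bullet> (P *v q) > 0"
    using ne pos[of p] pos[of q] psd_nonneg[OF P, of p] psd_nonneg[OF P, of q] by fastforce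
  ultimately have "\<alpha> = 0" by simp
  show thesis
  proof (cases "\<beta> = 0")
    case True
    have *: thesis if z: "P *v z \<noteq> 0" "S *v z = 0" for z
      using z pos[OF z(1)] by (intro eigen[of z 0 0]) simp_all
    from ne show ?thesis
      using *[of p] *[of q] by (auto simp: Sp Sq True \<open>\<alpha> = 0\<close>)
  next
    case False
    have 0: "q \<bullet> (P *v p) = 0"
      using pSp False unfolding Sp by (simp add: \<open>\<alpha> = 0\<close> pPq)
    have "p \<bullet> (P *v p) = q \<bullet> (P *v q)"
      using skew'[of p q] False unfolding Sp Sq by (simp add: \<open>\<alpha> = 0\<close>)
    then show ?thesis
      using eigen[of p \<beta> q] Sp Sq 0 \<open>p \<bullet> (P *v p) + q \<bullet> (P *v q) > 0\<close> by (simp add: \<open>\<alpha> = 0\<close>)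
  qed
qed

text \<open>An eigenpair of (S, P) provides a piece of the shape in \<open>freq\<close> whose
  subtraction, scaled by 1/c, keeps the block positive semidefinite and S skew while lowering the
  rank of P. Once P = 0, positivity forces S = 0, and R is left to
  \<open>psd_linear_functional_nonneg\<close>.\<close>

lemma psd_block_linear_functional_nonneg:
  fixes \<Phi> :: "(real^'n^'n) \<times> (real^'n^'n) \<times> (real^'n^'n) \<Rightarrow> real"
  assumes lin: "linear \<Phi>"
    and freq: "\<And>a b \<omega>. 0 \<le> \<Phi> (outer a a + outer b b, \<omega> *\<^sub>R (outer a b - outer b a),
      \<omega>\<^sup>2 *\<^sub>R (outer a a + outer b b))"
    and outer: "\<And>y. 0 \<le> \<Phi> (0, 0, outer y y)"
    and "psd_block P S R" "transpose S = - S"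
  shows "0 \<le> \<Phi> (P, S, R)"
  using \<open>psd_block P S R\<close> \<open>transpose S = - S\<close>
proof (induction "CARD('n) - dim {x. P *v x = 0}" arbitrary: P S R rule: less_induct)
  case less
  note Z = less.prems(1)
  show ?case
  proof (cases "P = 0")
    case True
    have "S *v x = 0" for x
      using psd_block_kernel[OF Z] True by simp
    then have "S = 0"
      by (simp add: matrix_eq)
    have "linear (\<lambda>R. \<Phi> (0, 0, R))"
      using linear_compose[of "\<lambda>R. (0, 0, R)" \<Phi>] lin by (simp add: o_def linear_iff)
    from psd_linear_functional_nonneg[OF this outer psd_blockD(2)[OF Z]] show ?thesis
      by (simp add: True \<open>S = 0\<close>)
  next
    case False
    note P = psd_blockD(1)[OF Z]
    note sym = sym_mat_inner[OF psd_sym[OF P]]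
    obtain p q \<omega> where Sp: "S *v p = - \<omega> *\<^sub>R (P *v q)" and Sq: "S *v q = \<omega> *\<^sub>R (P *v p)"
      and c0: "p \<bullet> (P *v p) > 0" and qq: "q \<bullet> (P *v q) \<le> p \<bullet> (P *v p)" and qp: "q \<bullet> (P *v p) = 0"
      by (rule psd_block_eigenpair[OF Z less.prems(2) False])
    define c a b where "c = p \<bullet> (P *v p)" and "a = P *v p" and "b = P *v q"
    define D E where "D = outer a a + outer b b" and "E = outer a b - outer b a"
    define P' S' R' where "P' = P - (1 / c) *\<^sub>R D" and "S' = S - (1 / c) *\<^sub>R \<omega> *\<^sub>R E"
      and "R' = R - (1 / c) *\<^sub>R \<omega>\<^sup>2 *\<^sub>R D"
    have c: "c > 0" using c0 by (simp add: c_def)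
    have Dv: "D *v x = (a \<bullet> x) *\<^sub>R a + (b \<bullet> x) *\<^sub>R b" for x
      by (simp add: D_def matrix_vector_mult_add_rdistrib outer_mult_vec)
    have Ev: "E *v x = (b \<bullet> x) *\<^sub>R a - (a \<bullet> x) *\<^sub>R b" for x
      by (simp add: E_def matrix_vector_mult_diff_rdistrib outer_mult_vec)
    have P'v: "P' *v x = P *v x - (1 / c) *\<^sub>R (D *v x)" for x
      by (simp add: P'_def matrix_vector_mult_diff_rdistrib scaleR_matrix_vector)
    have "psd_block P' S' R'"
      unfolding psd_block_def
    proof (intro conjI allI)
      show "sym_mat P'" "sym_mat R'"
        using Z by (simp_all add: psd_block_def P'_def R'_def D_def sym_mat_def transpose_diff
            transpose_add transpose_scalar)
      fix x y
      \<comment> \<open>The inner products of (x, y) with (a, -\<omega> b) and (b, \<omega> a), the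
        two stacked vectors whose outer squares make up the subtracted piece.\<close>
      define s t where "s = a \<bullet> x - \<omega> * (b \<bullet> y)" and "t = b \<bullet> x + \<omega> * (a \<bullet> y)"
      \<comment> \<open>Shifting x by w completes the square: the cross terms amount to 2 (s^2 +
        t^2) / c, and the form of P at w to at most half of that, by \<open>qq\<close>.\<close>
      define w where "w = (s / c) *\<^sub>R p + (t / c) *\<^sub>R q"
      have Pw: "P *v w = (s / c) *\<^sub>R a + (t / c) *\<^sub>R b"
        by (simp add: w_def a_def b_def matrix_vector_right_distrib matrix_vector_mult_scaleR)
      have Sw: "S *v w = (t / c * \<omega>) *\<^sub>R a - (s / c * \<omega>) *\<^sub>R b"
        by (simp add: w_def a_def b_def Sp Sq matrix_vector_right_distrib matrix_vector_mult_scaleR)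
      have pPq: "p \<bullet> (P *v q) = 0"
        using sym[of p q] qp by (simp add: inner_commute)
      have wPw: "w \<bullet> (P *v w) = (s\<^sup>2 + t\<^sup>2 * (q \<bullet> (P *v q)) / c) / c"
        unfolding Pw unfolding w_def a_def b_def using c qp pPq
        by (simp add: inner_add_left inner_add_right c_def[symmetric] power2_eq_square field_simps)
      have "0 \<le> (x - w) \<bullet> (P *v (x - w)) + 2 * (y \<bullet> (S *v (x - w))) + y \<bullet> (R *v y)"
        using Z unfolding psd_block_def by blast
      also have "\<dots> = x \<bullet> (P *v x) + 2 * (y \<bullet> (S *v x)) + y \<bullet> (R *v y)
          - (2 * (x \<bullet> (P *v w)) + 2 * (y \<bullet> (S *v w))) + w \<bullet> (P *v w)"
        by (simp add: matrix_vector_mult_diff_distrib inner_diff_left inner_diff_right sym[of w x]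
            inner_commute)
      finally have "0 \<le> x \<bullet> (P *v x) + 2 * (y \<bullet> (S *v x)) + y \<bullet> (R *v y)
          - (2 * (x \<bullet> (P *v w)) + 2 * (y \<bullet> (S *v w))) + w \<bullet> (P *v w)" .
      moreover have "2 * (x \<bullet> (P *v w)) + 2 * (y \<bullet> (S *v w)) = 2 * ((s\<^sup>2 + t\<^sup>2) / c)"
        unfolding Pw Sw s_def t_def using c
        by (simp add: inner_add_right inner_diff_right inner_commute power2_eq_square field_simps)
      moreover have "w \<bullet> (P *v w) \<le> (s\<^sup>2 + t\<^sup>2) / c"
      proof -
        have "t\<^sup>2 * (q \<bullet> (P *v q)) / c \<le> t\<^sup>2"
          using qq c by (simp add: c_def[symmetric] pos_divide_le_eq mult_left_mono)
        then show ?thesis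
          unfolding wPw using c by (simp add: divide_right_mono)
      qed
      ultimately have "0 \<le> x \<bullet> (P *v x) + 2 * (y \<bullet> (S *v x)) + y \<bullet> (R *v y) - (s\<^sup>2 + t\<^sup>2) / c"
        by linarith
      also have "\<dots> = x \<bullet> (P' *v x) + 2 * (y \<bullet> (S' *v x)) + y \<bullet> (R' *v y)"
        unfolding P'_def S'_def R'_def s_def t_def
        by (simp add: matrix_vector_mult_diff_rdistrib scaleR_matrix_vector Dv Ev inner_diff_right
            inner_add_right inner_commute power2_eq_square add_divide_distrib diff_divide_distrib
            algebra_simps)
      finally show "0 \<le> x \<bullet> (P' *v x) + 2 * (y \<bullet> (S' *v x)) + y \<bullet> (R' *v y)" .
    qed
    moreover have "transpose S' = - S'"
      using less.prems(2) by (simp add: S'_def E_def transpose_diff transpose_add transpose_scalar algebra_simps)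
    moreover have "CARD('n) - dim {x. P' *v x = 0} < CARD('n) - dim {x. P *v x = 0}"
    proof (rule dim_kernel_less)
      show "P' *v x = 0" if "P *v x = 0" for x
        using that sym[of p x] sym[of q x] by (simp add: P'v Dv a_def b_def)
      show "P' *v p = 0"
        using c qp sym[of q p] unfolding P'v Dv a_def b_def
        by (simp add: c_def[symmetric] inner_commute)
      show "P *v p \<noteq> 0"
        using c0 by auto
    qed
    ultimately have "0 \<le> \<Phi> (P', S', R')"
      using less.hyps by blast
    moreover have "\<Phi> (P, S, R) = \<Phi> (P', S', R') + (1 / c) * \<Phi> (D, \<omega> *\<^sub>R E, \<omega>\<^sup>2 *\<^sub>R D)"
    proof -
      have "(P, S, R) = (P', S', R') + (1 / c) *\<^sub>R (D, \<omega> *\<^sub>R E, \<omega>\<^sup>2 *\<^sub>R D)"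
        by (simp add: P'_def S'_def R'_def)
      then show ?thesis
        by (metis linear_add[OF lin] linear_scale[OF lin] real_scaleR_def)
    qed
    ultimately show ?thesis
      using freq[of a b \<omega>] c unfolding D_def E_def by simp
  qed
qed

text \<open>The pairs \<open>(c a, -s b)\<close> and \<open>(c b, s a)\<close> are the real and imaginary parts of
  \<open>(c z, \<i> s z)\<close> for \<open>z = a + \<i> b\<close>, so the hypothesis is the frequency domain inequality on the imaginary
  axis including the point at infinity.\<close>

lemma kyp_strict:
  fixes N11 N21 N22 :: "real^'n^'n"
  defines "q \<equiv> \<lambda>x y. x \<bullet> (N11 *v x) + 2 * (y \<bullet> (N21 *v x)) + y \<bullet> (N22 *v y)"
  assumes freq: "\<And>a b c s. (a, b) \<noteq> (0, 0) \<Longrightarrow> (c, s) \<noteq> (0, 0) \<Longrightarrow>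
      0 < q (c *\<^sub>R a) (- s *\<^sub>R b) + q (c *\<^sub>R b) (s *\<^sub>R a)"
  shows "\<exists>P. sym_mat P \<and> (\<forall>x y. (x, y) \<noteq> (0, 0) \<longrightarrow> 2 * (x \<bullet> (P *v y)) < q x y)"
proof -
  define F where "F z k = q (fst k *\<^sub>R fst z) (- snd k *\<^sub>R snd z) + q (fst k *\<^sub>R snd z) (snd k *\<^sub>R fst z)"
    for z :: "(real^'n) \<times> (real^'n)" and k :: "real \<times> real"
  have cont_q: "continuous_on X (\<lambda>x. q (f x) (g x))" if "continuous_on X f" "continuous_on X g"
    for X :: "'c::topological_space set" and f g
    unfolding q_def by (intro continuous_intros that)
  have q_scale: "q (t *\<^sub>R x) (t *\<^sub>R y) = t\<^sup>2 * q x y" for t x y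
    by (simp add: q_def matrix_vector_mult_scaleR power2_eq_square algebra_simps)
  let ?K = "sphere 0 1 \<times> sphere 0 1 :: (((real^'n) \<times> (real^'n)) \<times> (real \<times> real)) set"
  have "\<exists>m\<in>?K. \<forall>k\<in>?K. F (fst m) (snd m) \<le> F (fst k) (snd k)"
  proof (rule continuous_attains_inf)
    show "compact ?K" by (intro compact_Times compact_sphere)
    show "?K \<noteq> {}" by (simp add: sphere_eq_empty)
    show "continuous_on ?K (\<lambda>k. F (fst k) (snd k))"
      unfolding F_def by (intro continuous_intros cont_q)
  qed
  then obtain z0 k0 where zk: "norm z0 = 1" "norm k0 = 1"
    and min: "\<And>z k. norm z = 1 \<Longrightarrow> norm k = 1 \<Longrightarrow> F z0 k0 \<le> F z k"
    by auto
  \<comment> \<open>Compactness of both spheres makes the frequency condition uniform, the infinite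
    frequency c = 0 included. The margin is what later rules out 0 in \<open>G\<close>.\<close>
  define \<epsilon> where "\<epsilon> = F z0 k0"
  have "\<epsilon> > 0"
    unfolding \<epsilon>_def F_def using zk
    by (intro freq) (metis norm_zero prod.collapse zero_prod_def zero_neq_one)+
  have F_scale: "F (r *\<^sub>R z) (t *\<^sub>R k) = r\<^sup>2 * t\<^sup>2 * F z k" for r t z k
  proof -
    have "F (r *\<^sub>R z) (t *\<^sub>R k) = q ((r * t) *\<^sub>R fst k *\<^sub>R fst z) ((r * t) *\<^sub>R (- snd k *\<^sub>R snd z))
        + q ((r * t) *\<^sub>R fst k *\<^sub>R snd z) ((r * t) *\<^sub>R snd k *\<^sub>R fst z)"
      by (simp add: F_def mult_ac)
    then show ?thesis
      unfolding q_scale F_def by (simp add: power_mult_distrib algebra_simps)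
  qed
  have F_ge: "\<epsilon> * (norm z)\<^sup>2 * (norm k)\<^sup>2 \<le> F z k" for z k
  proof (cases "z = 0 \<or> k = 0")
    case True
    then show ?thesis by (auto simp: F_def q_def)
  next
    case False
    then have "\<epsilon> \<le> F (z /\<^sub>R norm z) (k /\<^sub>R norm k)"
      unfolding \<epsilon>_def by (intro min) simp_all
    also have "\<dots> = F z k / ((norm z)\<^sup>2 * (norm k)\<^sup>2)"
      unfolding F_scale by (simp add: power_inverse field_simps)
    finally show ?thesis
      using False by (simp add: pos_le_divide_eq mult.assoc)
  qed
  define \<Psi> where "\<Psi> = (\<lambda>(P, S, R). N11 \<bullet> P + 2 * (N21 \<bullet> S) + N22 \<bullet> R)"
  \<comment> \<open>On a frequency piece the two traces add up to the product of squared norms in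
    \<open>F_ge\<close>, so \<open>F_ge\<close> gives nonnegativity of \<Phi> there. Deflation
    carries it to all blocks with skew S, where \<Psi> then dominates \<epsilon> times the
    trace.\<close>
  define \<Phi> where "\<Phi> = (\<lambda>(P, S, R). \<Psi> (P, S, R) - \<epsilon> * (trace P + trace R))"
  have \<Psi>_add: "\<Psi> (Z + Z') = \<Psi> Z + \<Psi> Z'" and \<Psi>_scale: "\<Psi> (t *\<^sub>R Z) = t * \<Psi> Z" for t Z Z'
    by (cases Z; cases Z'; simp add: \<Psi>_def algebra_simps)+
  have \<Psi>_outer: "\<Psi> (outer x x, outer y x, outer y y) = q x y" for x y
    by (simp add: \<Psi>_def inner_outer q_def)
  have "linear \<Phi>"
  proof (rule linearI)
    show "\<Phi> (Z + Z') = \<Phi> Z + \<Phi> Z'" for Z Z'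
      using \<Psi>_add[of Z Z'] by (cases Z; cases Z'; simp add: \<Phi>_def trace_add algebra_simps)
    show "\<Phi> (t *\<^sub>R Z) = t *\<^sub>R \<Phi> Z" for t Z
      using \<Psi>_scale[of t Z] by (cases Z; simp add: \<Phi>_def trace_scaleR algebra_simps)
  qed
  have \<Phi>_nonneg: "0 \<le> \<Phi> (P, S, R)" if "psd_block P S R" "transpose S = - S" for P S R
  proof (rule psd_block_linear_functional_nonneg[OF \<open>linear \<Phi>\<close> _ _ that])
    fix a b :: "real^'n" and \<omega> :: real
    have "(outer a a + outer b b, \<omega> *\<^sub>R (outer a b - outer b a), \<omega>\<^sup>2 *\<^sub>R (outer a a + outer b b))
        = (outer a a, outer (- \<omega> *\<^sub>R b) a, outer (- \<omega> *\<^sub>R b) (- \<omega> *\<^sub>R b))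
          + (outer b b, outer (\<omega> *\<^sub>R a) b, outer (\<omega> *\<^sub>R a) (\<omega> *\<^sub>R a))"
      by (simp add: outer_scaleR_left outer_scaleR_right power2_eq_square algebra_simps
          del: scaleR_minus_left, simp)
    then have "\<Psi> (outer a a + outer b b, \<omega> *\<^sub>R (outer a b - outer b a), \<omega>\<^sup>2 *\<^sub>R (outer a a + outer b b))
        = F (a, b) (1, \<omega>)"
      by (simp only: \<Psi>_add \<Psi>_outer) (simp add: F_def)
    moreover have "trace (outer a a + outer b b) + trace (\<omega>\<^sup>2 *\<^sub>R (outer a a + outer b b))
        = (norm (a, b))\<^sup>2 * (norm (1 :: real, \<omega>))\<^sup>2"
      by (simp add: trace_add trace_scaleR trace_outer norm_Pair power2_norm_eq_inner algebra_simps)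
    ultimately show "0 \<le> \<Phi> (outer a a + outer b b, \<omega> *\<^sub>R (outer a b - outer b a),
        \<omega>\<^sup>2 *\<^sub>R (outer a a + outer b b))"
      using F_ge[of "(a, b)" "(1, \<omega>)"] by (simp add: \<Phi>_def mult.assoc)
    show "0 \<le> \<Phi> (0, 0, outer a a)"
      using F_ge[of "(a, 0)" "(0, 1)"] \<Psi>_outer[of 0 a]
      by (simp add: \<Phi>_def F_def q_def trace_outer norm_Pair power2_norm_eq_inner trace_def[of 0])
  qed
  define f where "f = (\<lambda>(x, y). (outer y x + outer x y, q x y))"
  \<comment> \<open>The point (0, 1) forces the scalar part r of the separating functional to be
    positive, so that it can be divided out.\<close>
  let ?S = "insert (0, 1) (f ` sphere 0 1)"
  \<comment> \<open>Vanishing of the first component says that S is skew. The slack t accommodates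
    the point (0, 1), and the trace condition again excludes the trivial combination.\<close>
  define G where "G = {(S + transpose S, \<Psi> (P, S, R) + t) |P S R t.
      psd_block P S R \<and> 0 \<le> t \<and> 0 < trace P + trace R + t}"
  have "compact ?S"
    unfolding f_def case_prod_unfold
    by (intro compact_insert compact_continuous_image continuous_intros cont_q compact_sphere)
  moreover have "?S \<subseteq> G"
  proof -
    have "(0, 1) \<in> G"
      unfolding G_def using psd_block_outer[of 0 0]
      by (intro CollectI exI[of _ 0] exI[of _ 1]) (simp add: \<Psi>_def transpose_def vec_eq_iff zero_prod_def trace_def)
    moreover have "f (x, y) \<in> G" if "norm (x, y) = 1" for x y
    proof -
      have "0 < trace (outer x x) + trace (outer y y)"
        using that by (simp add: trace_outer norm_Pair power2_norm_eq_inner)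
      then show ?thesis
        unfolding G_def using psd_block_outer[of x y]
        by (intro CollectI exI[of _ "outer x x"] exI[of _ "outer y x"] exI[of _ "outer y y"] exI[of _ 0])
          (simp add: f_def \<Psi>_outer)
    qed
    ultimately show ?thesis by auto
  qed
  moreover have "convex G"
  proof (rule convexI)
    fix g g' and u v :: real
    assume "g \<in> G" "g' \<in> G" and uv: "0 \<le> u" "0 \<le> v" "u + v = 1"
    then obtain P S R t P' S' R' t' where
      g: "g = (S + transpose S, \<Psi> (P, S, R) + t)" "psd_block P S R" "0 \<le> t" "0 < trace P + trace R + t" and
      g': "g' = (S' + transpose S', \<Psi> (P', S', R') + t')" "psd_block P' S' R'" "0 \<le> t'"
        "0 < trace P' + trace R' + t'"
      by (auto simp: G_def)
    have "\<Psi> (u *\<^sub>R P + v *\<^sub>R P', u *\<^sub>R S + v *\<^sub>R S', u *\<^sub>R R + v *\<^sub>R R') = u * \<Psi> (P, S, R) + v * \<Psi> (P', S', R')"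
      using \<Psi>_add[of "u *\<^sub>R (P, S, R)" "v *\<^sub>R (P', S', R')"] \<Psi>_scale[of u "(P, S, R)"]
        \<Psi>_scale[of v "(P', S', R')"] by simp
    then have "u *\<^sub>R g + v *\<^sub>R g' = ((u *\<^sub>R S + v *\<^sub>R S') + transpose (u *\<^sub>R S + v *\<^sub>R S'),
        \<Psi> (u *\<^sub>R P + v *\<^sub>R P', u *\<^sub>R S + v *\<^sub>R S', u *\<^sub>R R + v *\<^sub>R R') + (u * t + v * t'))"
      by (simp add: g g' transpose_add transpose_scalar algebra_simps)
    moreover have "0 < trace (u *\<^sub>R P + v *\<^sub>R P') + trace (u *\<^sub>R R + v *\<^sub>R R') + (u * t + v * t')"
      using convex_comb_pos[OF uv g(4) g'(4)] by (simp add: trace_add trace_scaleR algebra_simps)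
    moreover have "0 \<le> u * t + v * t'"
      using uv g g' by simp
    ultimately show "u *\<^sub>R g + v *\<^sub>R g' \<in> G"
      unfolding G_def using psd_block_comb[OF g(2) g'(2) uv(1,2)] by blast
  qed
  moreover have "0 \<notin> G"
  proof
    assume "0 \<in> G"
    then obtain P S R t where *: "S + transpose S = 0" "\<Psi> (P, S, R) + t = 0" "psd_block P S R" "0 \<le> t"
      "0 < trace P + trace R + t"
      by (auto simp: G_def zero_prod_def)
    have "0 \<le> \<Phi> (P, S, R)"
      using * by (intro \<Phi>_nonneg) (simp_all add: add_eq_0_iff)
    then have "\<epsilon> * (trace P + trace R) \<le> - t"
      using * by (simp add: \<Phi>_def)
    moreover have "0 \<le> trace P + trace R"
      using psd_blockD[OF *(3)] by (simp add: psd_trace_nonneg)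
    ultimately show False
      using \<open>\<epsilon> > 0\<close> * by (smt (verit) mult_nonneg_nonneg mult_pos_pos)
  qed
  ultimately obtain w where w: "\<forall>s\<in>?S. 0 < w \<bullet> s"
    using compact_separation by blast
  obtain M r where Mr: "w = (M, r)" by force
  have "r > 0"
    using w by (simp add: Mr)
  \<comment> \<open>The functional at f (x, y) reads y . M x + x . M y + r q x y; its positivity,
    solved for q x y, dictates this P.\<close>
  let ?P = "(- 1 / (2 * r)) *\<^sub>R (M + transpose M)"
  have "sym_mat ?P"
    by (simp add: sym_mat_def transpose_add transpose_scalar transpose_minus add.commute)
  moreover have "2 * (x \<bullet> (?P *v y)) < q x y" if "(x, y) \<noteq> (0, 0)" for x y
  proof -
    let ?n = "norm (x, y)"
    let ?h = "\<lambda>x y. y \<bullet> (M *v x) + x \<bullet> (M *v y) + r * q x y"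
    have n: "?n > 0" using that by (simp add: zero_prod_def)
    have "(1 / ?n) *\<^sub>R (x, y) \<in> sphere 0 1"
      unfolding mem_sphere_0 norm_scaleR using n by simp
    then have "0 < w \<bullet> f ((1 / ?n) *\<^sub>R (x, y))"
      using w by blast
    also have "\<dots> = ?h ((1 / ?n) *\<^sub>R x) ((1 / ?n) *\<^sub>R y)"
      by (simp add: Mr f_def inner_add_right inner_outer)
    also have "\<dots> = (1 / ?n)\<^sup>2 * ?h x y"
      unfolding q_scale by (simp add: matrix_vector_mult_scaleR power2_eq_square add_divide_distrib algebra_simps)
    finally have "0 < ?h x y"
      using n by (simp add: zero_less_mult_iff)
    then have "- (x \<bullet> (M *v y) + y \<bullet> (M *v x)) / r < q x y"
      using \<open>r > 0\<close> by (simp add: pos_divide_less_eq algebra_simps)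
    moreover have "x \<bullet> (?P *v y) = - (x \<bullet> (M *v y) + y \<bullet> (M *v x)) / (2 * r)"
      using inner_matrix_transpose[of x "transpose M" y]
      by (simp add: minus_matrix_vector scaleR_matrix_vector matrix_vector_mult_add_rdistrib
          inner_add_right inner_commute add_divide_distrib diff_divide_distrib)
    ultimately show ?thesis
      by (simp only:)
  qed
  ultimately show ?thesis by blast
qed

subsection \<open>The bounded real lemma\<close>

text \<open>Negative definiteness of A^T P + P A + \<theta> P V V^T P + H. The parameter \<theta>
  stands for 1 / \<gamma>^2 because the expression is affine in it.\<close>

definition riccati :: "real^'n^'n \<Rightarrow> real^'n^'n \<Rightarrow> real^'n^'n \<Rightarrow> real \<Rightarrow> real^'n^'n \<Rightarrow> bool" where
  "riccati A V H \<theta> P \<longleftrightarrow> pd P \<and> (\<forall>x. x \<noteq> 0 \<longrightarrow>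
     2 * ((P *v x) \<bullet> (A *v x)) + \<theta> * (norm (transpose V *v (P *v x)))\<^sup>2 + x \<bullet> (H *v x) < 0)"

text \<open>With \<open>G\<close> the inverse of the input matrix \<open>V\<close>, this is the bound \<open>\<gamma>\<close> for the gain on the imaginary
  axis, stated for the state \<open>a + \<i> b\<close> in place of the input \<open>G (\<i> \<omega> - A) (a + \<i> b)\<close> producing it.\<close>

definition freq_bound :: "real^'n^'n \<Rightarrow> real^'n^'n \<Rightarrow> real^'n^'n \<Rightarrow> real \<Rightarrow> bool" where
  "freq_bound A G H \<gamma> \<longleftrightarrow> (\<forall>a b \<omega>. a \<bullet> (H *v a) + b \<bullet> (H *v b) \<le>
     \<gamma>\<^sup>2 * ((norm (G *v (- \<omega> *\<^sub>R b - A *v a)))\<^sup>2 + (norm (G *v (\<omega> *\<^sub>R a - A *v b)))\<^sup>2))"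

text \<open>Compactness of the unit sphere turns strict inequalities between quadratic forms into a
  margin that can be spent on moving a level.\<close>

lemma homogeneous_pos_margin:
  fixes f :: "'a::euclidean_space \<Rightarrow> real"
  assumes cont: "continuous_on UNIV f" and hom: "\<And>t x. f (t *\<^sub>R x) = t\<^sup>2 * f x"
    and pos: "\<And>x. x \<noteq> 0 \<Longrightarrow> 0 < f x"
  shows "\<exists>\<epsilon>>0. \<forall>x. \<epsilon> * (norm x)\<^sup>2 \<le> f x"
proof -
  have "\<exists>m\<in>sphere 0 1. \<forall>x\<in>sphere 0 1. f m \<le> f x"
    by (rule continuous_attains_inf) (auto simp: sphere_eq_empty intro: continuous_on_subset[OF cont])
  then obtain m where m: "norm m = 1" and min: "\<And>x. norm x = 1 \<Longrightarrow> f m \<le> f x"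
    by auto
  have "f m * (norm x)\<^sup>2 \<le> f x" for x
  proof (cases "x = 0")
    case True
    then show ?thesis using hom[of 0 0] by simp
  next
    case False
    then have "f m * (norm x)\<^sup>2 \<le> f ((1 / norm x) *\<^sub>R x) * (norm x)\<^sup>2"
      by (intro mult_right_mono min) simp_all
    then show ?thesis
      using False by (simp add: hom power_divide)
  qed
  moreover have "f m > 0"
    using m by (intro pos) auto
  ultimately show ?thesis by blast
qed

lemma matrix_vector_pos_bounded:
  fixes M :: "real^'n^'m"
  obtains c where "0 < c" "\<And>x. norm (M *v x) \<le> c * norm x"
  using bounded_linear.pos_bounded[OF matrix_vector_mul_bounded_linear[of M]]
  by (metis mult.commute)

lemma quadratic_form_bounded:
  fixes M :: "real^'n^'n"
  obtains c where "0 < c" "\<And>x. x \<bullet> (M *v x) \<le> c * (norm x)\<^sup>2"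
proof -
  obtain c where c: "0 < c" "\<And>x. norm (M *v x) \<le> c * norm x"
    using matrix_vector_pos_bounded[of M] by blast
  have "x \<bullet> (M *v x) \<le> c * (norm x)\<^sup>2" for x
  proof -
    have "x \<bullet> (M *v x) \<le> norm x * norm (M *v x)"
      by (rule norm_cauchy_schwarz)
    also have "\<dots> \<le> norm x * (c * norm x)"
      by (intro mult_left_mono c) simp
    finally show ?thesis by (simp add: power2_eq_square mult_ac)
  qed
  with c(1) that show ?thesis by blast
qed

lemma riccati_hurwitz:
  assumes P: "riccati A V H \<theta> P" and "psd H" "0 \<le> \<theta>"
  shows "hurwitz A"
  unfolding hurwitz_iff_eigenpair
proof (intro allI impI)
  fix a b \<alpha> \<beta>
  assume *: "(a \<noteq> 0 \<or> b \<noteq> 0) \<and> A *v a = \<alpha> *\<^sub>R a - \<beta> *\<^sub>R b \<and> A *v b = \<beta> *\<^sub>R a + \<alpha> *\<^sub>R b"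
  then have eig: "A *v a = \<alpha> *\<^sub>R a - \<beta> *\<^sub>R b" "A *v b = \<beta> *\<^sub>R a + \<alpha> *\<^sub>R b"
    by auto
  have pd: "pd P" using P by (simp add: riccati_def)
  have neg: "(P *v x) \<bullet> (A *v x) < 0" if "x \<noteq> 0" for x
  proof -
    have "2 * ((P *v x) \<bullet> (A *v x)) + \<theta> * (norm (transpose V *v (P *v x)))\<^sup>2 + x \<bullet> (H *v x) < 0"
      using P that by (simp add: riccati_def)
    moreover have "0 \<le> \<theta> * (norm (transpose V *v (P *v x)))\<^sup>2" "0 \<le> x \<bullet> (H *v x)"
      using assms by (simp_all add: psd_nonneg)
    ultimately show ?thesis by linarith
  qed
  then have "(P *v x) \<bullet> (A *v x) \<le> 0" for x
    by (cases "x = 0") (auto intro: less_imp_le)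
  then have "(P *v a) \<bullet> (A *v a) + (P *v b) \<bullet> (A *v b) < 0"
    using * neg[of a] neg[of b] by (smt (verit))
  also have "(P *v a) \<bullet> (A *v a) + (P *v b) \<bullet> (A *v b) = \<alpha> * (a \<bullet> (P *v a) + b \<bullet> (P *v b))"
    unfolding eig using sym_mat_inner[OF pd_sym[OF pd], of a b]
    by (simp add: inner_add_right inner_diff_right inner_commute algebra_simps)
  finally show "\<alpha> < 0"
    using psd_nonneg[OF pd_imp_psd[OF pd], of a] psd_nonneg[OF pd_imp_psd[OF pd], of b]
    by (simp add: mult_less_0_iff)
qed

text \<open>The quadratic term is at most -2 (P x) . (A x), and Cauchy-Schwarz allows one factor |P
  x| to be cancelled. The constant does not involve P, so the bound is uniform over all solutions at
  a given \<theta>.\<close>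

lemma riccati_norm_bound:
  assumes P: "riccati A V H \<theta> P" and "psd H" "0 \<le> \<theta>"
    and V: "\<And>x. \<kappa> * (norm x)\<^sup>2 \<le> (norm (transpose V *v x))\<^sup>2"
  shows "\<theta> * \<kappa> * norm (P *v x) \<le> 2 * norm (A *v x)"
proof (cases "P *v x = 0")
  case False
  then have "x \<noteq> 0" by auto
  then have "2 * ((P *v x) \<bullet> (A *v x)) + \<theta> * (norm (transpose V *v (P *v x)))\<^sup>2 + x \<bullet> (H *v x) < 0"
    using P by (simp add: riccati_def)
  moreover have "0 \<le> x \<bullet> (H *v x)"
    using assms by (simp add: psd_nonneg)
  moreover have "\<theta> * (\<kappa> * (norm (P *v x))\<^sup>2) \<le> \<theta> * (norm (transpose V *v (P *v x)))\<^sup>2"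
    using assms by (intro mult_left_mono) auto
  moreover have "- ((P *v x) \<bullet> (A *v x)) \<le> norm (P *v x) * norm (A *v x)"
    using norm_cauchy_schwarz[of "- (P *v x)" "A *v x"] by simp
  ultimately have "norm (P *v x) * (\<theta> * \<kappa> * norm (P *v x)) \<le> norm (P *v x) * (2 * norm (A *v x))"
    by (simp add: power2_eq_square algebra_simps)
  then show ?thesis
    using False by simp
qed simp

text \<open>The form x . P x acts as a storage function: its rate is bounded by completing the
  square in the input, and the rates of the real and imaginary parts of an oscillation cancel. The
  margin in the strict inequality pays for the drop below \<gamma>.\<close>

lemma riccati_imp_freq_bound:
  fixes A V G H P :: "real^'n^'n"
  assumes P: "riccati A V H (1 / \<gamma>\<^sup>2) P" and "0 < \<gamma>" and VG: "V ** G = mat 1"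
  shows "\<exists>\<gamma>'. 0 \<le> \<gamma>' \<and> \<gamma>' < \<gamma> \<and> freq_bound A G H \<gamma>'"
proof -
  let ?u = "\<lambda>x. transpose V *v (P *v x)"
  let ?f = "\<lambda>x. - (2 * ((P *v x) \<bullet> (A *v x)) + 1 / \<gamma>\<^sup>2 * (norm (?u x))\<^sup>2 + x \<bullet> (H *v x))"
  have "\<exists>\<epsilon>>0. \<forall>x. \<epsilon> * (norm x)\<^sup>2 \<le> ?f x"
  proof (rule homogeneous_pos_margin)
    show "continuous_on UNIV ?f"
      by (intro continuous_intros)
    show "?f (t *\<^sub>R x) = t\<^sup>2 * ?f x" for t x
      by (simp add: matrix_vector_mult_scaleR power_mult_distrib power2_eq_square[of t] algebra_simps)
    show "0 < ?f x" if "x \<noteq> 0" for x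
      using P that unfolding riccati_def neg_0_less_iff_less by blast
  qed
  then obtain \<epsilon> where \<epsilon>: "\<epsilon> > 0" "\<And>x. \<epsilon> * (norm x)\<^sup>2 \<le> ?f x"
    by blast
  obtain h where h: "0 < h" "\<And>x. x \<bullet> (H *v x) \<le> h * (norm x)\<^sup>2"
    using quadratic_form_bounded[of H] by blast
  have sym: "sym_mat P"
    using P by (simp add: riccati_def pd_sym)
  \<comment> \<open>Here y stands for the derivative of x, so \<open>?w\<close> is the input. Since
    h bounds the form of H, the margin \<epsilon> is worth at least \<epsilon> / h extra copies of
    that form.\<close>
  have dissip: "2 * ((P *v x) \<bullet> y) + (1 + \<epsilon> / h) * (x \<bullet> (H *v x)) \<le> \<gamma>\<^sup>2 * (norm (G *v (y - A *v x)))\<^sup>2" for x y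
  proof -
    let ?w = "G *v (y - A *v x)"
    have "V *v ?w = y - A *v x"
      by (simp add: matrix_vector_mul_assoc VG)
    then have "(P *v x) \<bullet> y = (P *v x) \<bullet> (A *v x) + ?u x \<bullet> ?w"
      by (simp add: inner_matrix_transpose[symmetric] inner_diff_right)
    moreover have "2 * (?u x \<bullet> ?w) \<le> 1 / \<gamma>\<^sup>2 * (norm (?u x))\<^sup>2 + \<gamma>\<^sup>2 * (norm ?w)\<^sup>2"
    proof -
      have "0 \<le> (norm ((1 / \<gamma>) *\<^sub>R ?u x - \<gamma> *\<^sub>R ?w))\<^sup>2" by simp
      also have "\<dots> = 1 / \<gamma>\<^sup>2 * (norm (?u x))\<^sup>2 + \<gamma>\<^sup>2 * (norm ?w)\<^sup>2 - 2 * (?u x \<bullet> ?w)"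
        using \<open>0 < \<gamma>\<close> unfolding power2_norm_eq_inner
        by (simp add: inner_diff_left inner_diff_right inner_commute power2_eq_square)
      finally show ?thesis by simp
    qed
    moreover have "\<epsilon> / h * (x \<bullet> (H *v x)) \<le> \<epsilon> * (norm x)\<^sup>2"
      using mult_left_mono[OF h(2)[of x], of "\<epsilon> / h"] h(1) \<epsilon>(1) by simp
    ultimately show ?thesis
      using \<epsilon>(2)[of x] by (simp add: algebra_simps)
  qed
  define r where "r = sqrt (1 + \<epsilon> / h)"
  have r: "r > 1" "r\<^sup>2 = 1 + \<epsilon> / h"
    using \<epsilon>(1) h(1) by (simp_all add: r_def add_pos_pos less_imp_le)
  have "freq_bound A G H (\<gamma> / r)"
    unfolding freq_bound_def
  proof (intro allI)
    fix a b :: "real^'n" and \<omega> :: real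
    have "(P *v a) \<bullet> (- \<omega> *\<^sub>R b) + (P *v b) \<bullet> (\<omega> *\<^sub>R a) = 0"
      using sym_mat_inner[OF sym, of a b] by (simp add: inner_commute)
    with dissip[of a "- \<omega> *\<^sub>R b"] dissip[of b "\<omega> *\<^sub>R a"]
    have "r\<^sup>2 * (a \<bullet> (H *v a) + b \<bullet> (H *v b)) \<le>
        \<gamma>\<^sup>2 * ((norm (G *v (- \<omega> *\<^sub>R b - A *v a)))\<^sup>2 + (norm (G *v (\<omega> *\<^sub>R a - A *v b)))\<^sup>2)"
      unfolding r(2) distrib_left by linarith
    then show "a \<bullet> (H *v a) + b \<bullet> (H *v b) \<le>
        (\<gamma> / r)\<^sup>2 * ((norm (G *v (- \<omega> *\<^sub>R b - A *v a)))\<^sup>2 + (norm (G *v (\<omega> *\<^sub>R a - A *v b)))\<^sup>2)"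
      using r(1) by (simp add: power_divide pos_le_divide_eq mult.commute)
  qed
  moreover have "0 \<le> \<gamma> / r" "\<gamma> / r < \<gamma>"
    using r(1) \<open>0 < \<gamma>\<close> by (simp_all add: divide_less_eq)
  ultimately show ?thesis by blast
qed

text \<open>\<open>kyp_strict\<close> is applied to \<gamma>^2 |G (y - A x)|^2 - x . H x. Inserting
  for y the derivative under the worst input turns the resulting inequality into the Riccati one,
  and P is positive definite because A is Hurwitz.\<close>

lemma riccati_exists:
  assumes A: "hurwitz A" and F: "freq_bound A G H \<gamma>'" and \<gamma>: "0 \<le> \<gamma>'" "\<gamma>' < \<gamma>"
    and H: "pd H" and inv: "V ** G = mat 1" "G ** V = mat 1"
  shows "\<exists>P. riccati A V H (1 / \<gamma>\<^sup>2) P"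
proof -
  define N11 N21 N22 where "N11 = \<gamma>\<^sup>2 *\<^sub>R (transpose (G ** A) ** (G ** A)) - H"
    and "N21 = (- \<gamma>\<^sup>2) *\<^sub>R (transpose G ** (G ** A))" and "N22 = \<gamma>\<^sup>2 *\<^sub>R (transpose G ** G)"
  let ?q = "\<lambda>x y. x \<bullet> (N11 *v x) + 2 * (y \<bullet> (N21 *v x)) + y \<bullet> (N22 *v y)"
  have q: "?q x y = \<gamma>\<^sup>2 * (norm (G *v (y - A *v x)))\<^sup>2 - x \<bullet> (H *v x)" for x y
    unfolding N11_def N21_def N22_def power2_norm_eq_inner
    by (simp add: matrix_vector_mult_diff_rdistrib scaleR_matrix_vector minus_matrix_vector
        matrix_vector_mul_assoc[symmetric] inner_matrix_transpose[of _ "transpose _"]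
        matrix_vector_mult_diff_distrib inner_diff_right inner_diff_left inner_commute) (simp add: algebra_simps)
  have G0: "G *v x = 0 \<Longrightarrow> x = 0" for x
    by (metis inv(1) matrix_vector_mul_assoc matrix_vector_mul_lid matrix_vector_mult_0_right)
  have Hpos: "x \<noteq> 0 \<Longrightarrow> 0 < x \<bullet> (H *v x)" for x
    using H by (simp add: pd_def)
  have Hge: "0 \<le> x \<bullet> (H *v x)" for x
    using psd_nonneg[OF pd_imp_psd[OF H]] .
  have "0 < ?q (c *\<^sub>R a) (- s *\<^sub>R b) + ?q (c *\<^sub>R b) (s *\<^sub>R a)"
    if ne: "(a, b) \<noteq> (0, 0)" "(c, s) \<noteq> (0, 0)" for a b c s
  proof (cases "c = 0")
    \<comment> \<open>Infinite frequency: only \<gamma>^2 |G y|^2 remains, and injectivity of G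
      suffices.\<close>
    case True
    have "0 < s\<^sup>2 * ((norm (G *v a))\<^sup>2 + (norm (G *v b))\<^sup>2)"
      using ne True G0[of a] G0[of b]
      by (intro mult_pos_pos) (auto simp: sum_power2_gt_zero_iff)
    then have "0 < \<gamma>\<^sup>2 * (s\<^sup>2 * ((norm (G *v a))\<^sup>2 + (norm (G *v b))\<^sup>2))"
      using \<gamma> by simp
    moreover have "G *v (- s *\<^sub>R b - A *v (0 *\<^sub>R a)) = (- s) *\<^sub>R (G *v b)"
      "G *v (s *\<^sub>R a - A *v (0 *\<^sub>R b)) = s *\<^sub>R (G *v a)"
      by (simp_all only: scaleR_zero_left matrix_vector_mult_0_right diff_zero matrix_vector_mult_scaleR)
    ultimately show ?thesis
      unfolding q True by (simp add: power_mult_distrib distrib_left)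
  next
    case False
    let ?W = "(norm (G *v (- (s / c) *\<^sub>R b - A *v a)))\<^sup>2 + (norm (G *v ((s / c) *\<^sub>R a - A *v b)))\<^sup>2"
    let ?h = "a \<bullet> (H *v a) + b \<bullet> (H *v b)"
    have "0 < ?h"
      using ne(1) Hpos[of a] Hpos[of b] Hge[of a] Hge[of b] by fastforce
    moreover have le: "?h \<le> \<gamma>'\<^sup>2 * ?W"
      using F by (simp add: freq_bound_def)
    ultimately have "0 < \<gamma>'\<^sup>2 * ?W"
      by linarith
    then have "0 < ?W"
      by (simp add: zero_less_mult_iff)
    moreover have "\<gamma>'\<^sup>2 < \<gamma>\<^sup>2"
      using \<gamma> by (simp add: power_strict_mono)
    ultimately have "?h < \<gamma>\<^sup>2 * ?W"
      using le by (meson le_less_trans mult_strict_right_mono)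
    then have "0 < c\<^sup>2 * (\<gamma>\<^sup>2 * ?W - ?h)"
      using False by simp
    also have "\<dots> = \<gamma>\<^sup>2 * ((norm (c *\<^sub>R (G *v (- (s / c) *\<^sub>R b - A *v a))))\<^sup>2
        + (norm (c *\<^sub>R (G *v ((s / c) *\<^sub>R a - A *v b))))\<^sup>2) - c\<^sup>2 * ?h"
      unfolding norm_scaleR power_mult_distrib power2_abs by (simp add: algebra_simps)
    also have "c *\<^sub>R (G *v (- (s / c) *\<^sub>R b - A *v a)) = G *v (- s *\<^sub>R b - A *v (c *\<^sub>R a))"
      using False by (simp add: matrix_vector_mult_scaleR[symmetric] scaleR_diff_right)
    also have "c *\<^sub>R (G *v ((s / c) *\<^sub>R a - A *v b)) = G *v (s *\<^sub>R a - A *v (c *\<^sub>R b))"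
      using False by (simp add: matrix_vector_mult_scaleR[symmetric] scaleR_diff_right)
    also have "c\<^sup>2 * ?h = (c *\<^sub>R a) \<bullet> (H *v (c *\<^sub>R a)) + (c *\<^sub>R b) \<bullet> (H *v (c *\<^sub>R b))"
      by (simp add: matrix_vector_mult_scaleR power2_eq_square algebra_simps)
    finally show ?thesis
      unfolding q distrib_left by linarith
  qed
  from kyp_strict[of N11 N21 N22, OF this] obtain P where sym: "sym_mat P"
    and P: "\<And>x y. (x, y) \<noteq> (0, 0) \<Longrightarrow> 2 * (x \<bullet> (P *v y)) < ?q x y"
    by blast
  have ineq: "2 * ((P *v x) \<bullet> (A *v x)) + 1 / \<gamma>\<^sup>2 * (norm (transpose V *v (P *v x)))\<^sup>2 + x \<bullet> (H *v x) < 0"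
    if "x \<noteq> 0" for x
  proof -
    let ?z = "transpose V *v (P *v x)"
    \<comment> \<open>The worst input at x, maximising 2 (P x) . (V u) - \<gamma>^2 |u|^2.\<close>
    let ?u = "(1 / \<gamma>\<^sup>2) *\<^sub>R ?z"
    have "2 * (x \<bullet> (P *v (A *v x + V *v ?u))) < \<gamma>\<^sup>2 * (norm (G *v (V *v ?u)))\<^sup>2 - x \<bullet> (H *v x)"
      using P[of x "A *v x + V *v ?u"] that unfolding q by simp
    also have "G *v (V *v ?u) = ?u"
      by (simp only: matrix_vector_mul_assoc inv matrix_vector_mul_lid)
    also have "x \<bullet> (P *v (A *v x + V *v ?u)) = (P *v x) \<bullet> (A *v x) + 1 / \<gamma>\<^sup>2 * (norm ?z)\<^sup>2"
      unfolding power2_norm_eq_inner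
      by (simp add: sym_mat_inner[OF sym] inner_add_right inner_matrix_transpose[of _ V])
    also have "\<gamma>\<^sup>2 * (norm ?u)\<^sup>2 = 1 / \<gamma>\<^sup>2 * (norm ?z)\<^sup>2"
      using \<gamma> by (simp add: power_divide power2_eq_square)
    finally show ?thesis by (simp add: algebra_simps)
  qed
  have "pd P"
  proof (rule pd_if_lyapunov[OF A sym])
    show "(P *v x) \<bullet> (A *v x) < 0" if "x \<noteq> 0" for x
      using ineq[OF that] Hge[of x]
      by (smt (verit) divide_nonneg_nonneg mult_nonneg_nonneg zero_le_power2)
  qed
  then show ?thesis
    using ineq by (auto simp: riccati_def)
qed

text \<open>A Lyapunov solution, scaled up, solves the Riccati inequality for some large \<gamma>.
  The finite gain obtained makes the supremum in \<open>hinf_norm\<close> meaningful.\<close>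

lemma hurwitz_freq_bound:
  fixes A V G H :: "real^'n^'n"
  assumes A: "hurwitz A" and VG: "V ** G = mat 1"
  shows "\<exists>\<gamma>\<ge>0. freq_bound A G H \<gamma>"
proof -
  obtain P where P: "pd P" and neg: "\<And>x. x \<noteq> 0 \<Longrightarrow> (P *v x) \<bullet> (A *v x) < 0"
    using lyapunov_exists[OF A] by blast
  have "\<exists>\<epsilon>>0. \<forall>x. \<epsilon> * (norm x)\<^sup>2 \<le> - ((P *v x) \<bullet> (A *v x))"
    by (rule homogeneous_pos_margin)
      (use neg in \<open>auto intro!: continuous_intros simp: matrix_vector_mult_scaleR power2_eq_square\<close>)
  then obtain \<epsilon> where \<epsilon>: "\<epsilon> > 0" "\<And>x. \<epsilon> * (norm x)\<^sup>2 \<le> - ((P *v x) \<bullet> (A *v x))"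
    by blast
  obtain h where h: "0 < h" "\<And>x. x \<bullet> (H *v x) \<le> h * (norm x)\<^sup>2"
    using quadratic_form_bounded[of H] by blast
  \<comment> \<open>With this k the Lyapunov term is at most -2 h |x|^2, while H costs at most h
    |x|^2; \<gamma> is chosen below so that the quadratic term costs at most h |x|^2 / 2.\<close>
  define k where "k = h / \<epsilon>"
  have k: "k > 0" using \<epsilon> h by (simp add: k_def)
  obtain v where v: "0 < v" "\<And>x. norm ((transpose V ** (k *\<^sub>R P)) *v x) \<le> v * norm x"
    using matrix_vector_pos_bounded[of "transpose V ** (k *\<^sub>R P)"] by blast
  define \<gamma> where "\<gamma> = sqrt (2 * v\<^sup>2 / h)"
  have \<gamma>: "\<gamma> > 0" "1 / \<gamma>\<^sup>2 = h / (2 * v\<^sup>2)"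
    using v(1) h(1) by (simp_all add: \<gamma>_def)
  have "riccati A V H (1 / \<gamma>\<^sup>2) (k *\<^sub>R P)"
    unfolding riccati_def
  proof (intro conjI allI impI)
    show "pd (k *\<^sub>R P)"
      using P k by (simp add: pd_def sym_mat_def transpose_scalar scaleR_matrix_vector)
    fix x :: "real^'n" assume "x \<noteq> 0"
    have "(norm (transpose V *v ((k *\<^sub>R P) *v x)))\<^sup>2 \<le> (v * norm x)\<^sup>2"
      using v by (intro power_mono) (simp_all add: matrix_vector_mul_assoc)
    then have "1 / \<gamma>\<^sup>2 * (norm (transpose V *v ((k *\<^sub>R P) *v x)))\<^sup>2 \<le> h / (2 * v\<^sup>2) * (v * norm x)\<^sup>2"
      unfolding \<gamma>(2) using h(1) by (intro mult_left_mono) simp_all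
    also have "\<dots> = h * (norm x)\<^sup>2 / 2"
      using v(1) by (simp add: power_mult_distrib)
    finally have 1: "1 / \<gamma>\<^sup>2 * (norm (transpose V *v ((k *\<^sub>R P) *v x)))\<^sup>2 \<le> h * (norm x)\<^sup>2 / 2" .
    have "k * (\<epsilon> * (norm x)\<^sup>2) \<le> k * (- ((P *v x) \<bullet> (A *v x)))"
      using \<epsilon>(2) k by (intro mult_left_mono) simp_all
    then have 2: "h * (norm x)\<^sup>2 \<le> - (((k *\<^sub>R P) *v x) \<bullet> (A *v x))"
      using \<epsilon>(1) by (simp add: k_def scaleR_matrix_vector)
    have "0 < h * (norm x)\<^sup>2"
      using h(1) \<open>x \<noteq> 0\<close> by simp
    with 1 2 h(2)[of x]
    show "2 * (((k *\<^sub>R P) *v x) \<bullet> (A *v x)) + 1 / \<gamma>\<^sup>2 * (norm (transpose V *v ((k *\<^sub>R P) *v x)))\<^sup>2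
        + x \<bullet> (H *v x) < 0"
      by linarith
  qed
  from riccati_imp_freq_bound[OF this \<gamma>(1) VG] show ?thesis by blast
qed

subsection \<open>The H-infinity norm\<close>

text \<open>C^T C for the output matrix C of \<open>Tinf\<close>, so its form is the output energy;
  for symmetric square roots it equals Q_inf + K^T R_inf K.\<close>

definition weight :: "real^'n^'n \<Rightarrow> real^'m^'m \<Rightarrow> real^'n^'m \<Rightarrow> real^'n^'n" where
  "weight Qh Rh K = transpose Qh ** Qh + transpose (Rh ** K) ** (Rh ** K)"

lemma inner_weight:
  "x \<bullet> (weight Qh Rh K *v x) = (norm (Qh *v x))\<^sup>2 + (norm (Rh *v (K *v x)))\<^sup>2"
  by (simp add: weight_def matrix_vector_mult_add_rdistrib inner_add_right power2_norm_eq_inner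
      inner_matrix_transpose[of _ "transpose _"] matrix_vector_mul_assoc[symmetric])

lemma pd_weight:
  assumes Qh: "inj ((*v) Qh)"
  shows "pd (weight Qh Rh K)"
  unfolding pd_def
proof (intro conjI allI impI)
  show "sym_mat (weight Qh Rh K)"
    by (simp add: weight_def sym_mat_def transpose_add matrix_transpose_mul matrix_mul_assoc)
  show "0 < x \<bullet> (weight Qh Rh K *v x)" if "x \<noteq> 0" for x
  proof -
    have "Qh *v x \<noteq> 0"
      using injD[OF Qh, of x 0] that by auto
    then show ?thesis
      unfolding inner_weight by (simp add: add_pos_nonneg)
  qed
qed

definition output_mat :: "real^'n^'n \<Rightarrow> real^'m^'m \<Rightarrow> real^'n^'m \<Rightarrow> complex^'n^('n + 'm)" where
  "output_mat Qh Rh K = (\<chi> i j. case i of Inl a \<Rightarrow> cmat Qh $ a $ j | Inr b \<Rightarrow> cmat (Rh ** K) $ b $ j)"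

lemma norm_output_mat:
  "(norm (output_mat Qh Rh K *v cvec a b))\<^sup>2
    = a \<bullet> (weight Qh Rh K *v a) + b \<bullet> (weight Qh Rh K *v b)"
proof -
  have "output_mat Qh Rh K *v v
      = (\<chi> i. case i of Inl k \<Rightarrow> (cmat Qh *v v) $ k | Inr k \<Rightarrow> (cmat (Rh ** K) *v v) $ k)" for v
    by (simp add: output_mat_def vec_eq_iff matrix_vector_mult_def split: sum.split)
  then have "(norm (output_mat Qh Rh K *v v))\<^sup>2 = (norm (cmat Qh *v v))\<^sup>2 + (norm (cmat (Rh ** K) *v v))\<^sup>2" for v
    by (simp add: norm_vec_def L2_set_def sum_nonneg UNIV_Plus_UNIV[symmetric] sum.Plus del: UNIV_Plus_UNIV)
  then show ?thesis
    by (simp add: cmat_mult_cvec norm_cvec inner_weight matrix_vector_mul_assoc)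
qed

lemma smult_mat_vec: "mat s *v v = s *s v" for v :: "complex^'n"
  by (simp add: vec_eq_iff matrix_vector_mult_def mat_def if_distrib[of "\<lambda>x. x * _"] cong: if_cong)

lemma resolvent_cvec:
  "(mat (\<i> * of_real \<omega>) - cmat A) *v cvec a b = cvec (- \<omega> *\<^sub>R b - A *v a) (\<omega> *\<^sub>R a - A *v b)"
  by (simp add: matrix_vector_mult_diff_rdistrib smult_mat_vec smult_cvec cmat_mult_cvec cvec_diff)

text \<open>\<open>matrix_inv\<close> is defined by choice and says nothing before invertibility is
  known; that holds because i \<omega> has real part 0 and so is no eigenvalue of a Hurwitz
  matrix.\<close>

lemma resolvent_inverse:
  assumes "hurwitz A"
  defines "M \<omega> \<equiv> mat (\<i> * complex_of_real \<omega>) - cmat A"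
  shows "matrix_inv (M \<omega>) ** M \<omega> = mat 1" "M \<omega> ** matrix_inv (M \<omega>) = mat 1"
proof -
  have "v = 0" if "M \<omega> *v v = 0" for v
  proof (rule ccontr)
    assume "v \<noteq> 0"
    have "cmat A *v v = (\<i> * of_real \<omega>) *s v"
      using that by (simp add: M_def matrix_vector_mult_diff_rdistrib smult_mat_vec)
    with \<open>v \<noteq> 0\<close> assms(1) have "Re (\<i> * of_real \<omega>) < 0"
      unfolding hurwitz_def by blast
    then show False by simp
  qed
  then have "invertible (M \<omega>)"
    by (simp add: invertible_left_inverse matrix_left_invertible_ker)
  then have "\<exists>N. M \<omega> ** N = mat 1 \<and> N ** M \<omega> = mat 1"
    by (simp add: invertible_def)
  from someI_ex[OF this]
  show "matrix_inv (M \<omega>) ** M \<omega> = mat 1" "M \<omega> ** matrix_inv (M \<omega>) = mat 1"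
    unfolding matrix_inv_def by blast+
qed

lemma cmat_inverse: "M ** N = mat 1 \<Longrightarrow> cmat M *v (cmat N *v v) = v"
  by (rule cvec_exists[of v]) (simp add: cmat_mult_cvec matrix_vector_mul_assoc)

lemma Tinf_mult_vec:
  "Tinf A B Bw Qh Rh K s *v w
    = output_mat Qh Rh K *v (matrix_inv (mat s - cmat (A + B ** K)) *v (cmat Bw *v w))"
  by (simp add: Tinf_def output_mat_def Let_def matrix_vector_mul_assoc)

text \<open>At each frequency w = G (i \<omega> - A_K) (a + i b) is a bijection between states and
  inputs, so a gain bound over all inputs is the same as one over all states.\<close>

lemma onorm_Tinf_le_iff:
  fixes A :: "real^'n^'n" and B :: "real^'m^'n"
  assumes hur: "hurwitz (A + B ** K)" and inv: "Bw ** G = mat 1" "G ** Bw = mat 1" and "0 \<le> \<gamma>"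
  shows "(\<forall>\<omega>. onorm (\<lambda>x. Tinf A B Bw Qh Rh K (\<i> * complex_of_real \<omega>) *v x) \<le> \<gamma>)
    \<longleftrightarrow> freq_bound (A + B ** K) G (weight Qh Rh K) \<gamma>"
proof
  let ?T = "\<lambda>\<omega>. Tinf A B Bw Qh Rh K (\<i> * complex_of_real \<omega>)"
  let ?A = "A + B ** K"
  let ?M = "\<lambda>\<omega>. mat (\<i> * complex_of_real \<omega>) - cmat ?A"
  note res = resolvent_inverse[OF hur]
  show "freq_bound ?A G (weight Qh Rh K) \<gamma>" if T: "\<forall>\<omega>. onorm (\<lambda>x. ?T \<omega> *v x) \<le> \<gamma>"
    unfolding freq_bound_def
  proof (intro allI)
    fix a b :: "real^'n" and \<omega> :: real
    define w where "w = cmat G *v (?M \<omega> *v cvec a b)"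
    have w: "w = cvec (G *v (- \<omega> *\<^sub>R b - ?A *v a)) (G *v (\<omega> *\<^sub>R a - ?A *v b))"
      by (simp add: w_def resolvent_cvec cmat_mult_cvec)
    have "?T \<omega> *v w = output_mat Qh Rh K *v cvec a b"
      unfolding Tinf_mult_vec w_def cmat_inverse[OF inv(1)]
      by (simp add: matrix_vector_mul_assoc res)
    moreover have "norm (?T \<omega> *v w) \<le> \<gamma> * norm w"
    proof -
      have "norm (?T \<omega> *v w) \<le> onorm (\<lambda>x. ?T \<omega> *v x) * norm w"
        by (rule onorm) simp
      also have "\<dots> \<le> \<gamma> * norm w"
        using T by (intro mult_right_mono) simp_all
      finally show ?thesis .
    qed
    ultimately have "(norm (output_mat Qh Rh K *v cvec a b))\<^sup>2 \<le> (\<gamma> * norm w)\<^sup>2"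
      by (intro power_mono) simp_all
    then show "a \<bullet> (weight Qh Rh K *v a) + b \<bullet> (weight Qh Rh K *v b) \<le>
        \<gamma>\<^sup>2 * ((norm (G *v (- \<omega> *\<^sub>R b - ?A *v a)))\<^sup>2 + (norm (G *v (\<omega> *\<^sub>R a - ?A *v b)))\<^sup>2)"
      by (simp add: norm_output_mat power_mult_distrib w norm_cvec)
  qed
  show "\<forall>\<omega>. onorm (\<lambda>x. ?T \<omega> *v x) \<le> \<gamma>" if F: "freq_bound ?A G (weight Qh Rh K) \<gamma>"
  proof (intro allI onorm_bound \<open>0 \<le> \<gamma>\<close>)
    fix \<omega> w
    obtain a b where ab: "matrix_inv (?M \<omega>) *v (cmat Bw *v w) = cvec a b"
      by (rule cvec_exists)
    have "?M \<omega> *v cvec a b = cmat Bw *v w"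
      by (simp add: ab[symmetric] matrix_vector_mul_assoc matrix_mul_assoc res)
    then have "w = cmat G *v (?M \<omega> *v cvec a b)"
      by (simp add: cmat_inverse[OF inv(2)])
    then have w: "w = cvec (G *v (- \<omega> *\<^sub>R b - ?A *v a)) (G *v (\<omega> *\<^sub>R a - ?A *v b))"
      by (simp add: resolvent_cvec cmat_mult_cvec)
    have "(norm (?T \<omega> *v w))\<^sup>2 = a \<bullet> (weight Qh Rh K *v a) + b \<bullet> (weight Qh Rh K *v b)"
      by (simp add: Tinf_mult_vec ab norm_output_mat)
    also have "\<dots> \<le> \<gamma>\<^sup>2 * (norm w)\<^sup>2"
      using F by (simp add: freq_bound_def w norm_cvec)
    finally have "(norm (?T \<omega> *v w))\<^sup>2 \<le> (\<gamma> * norm w)\<^sup>2"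
      by (simp add: power_mult_distrib)
    then show "norm (?T \<omega> *v w) \<le> \<gamma> * norm w"
      using \<open>0 \<le> \<gamma>\<close> by (simp add: abs_le_square_iff[symmetric])
  qed
qed

text \<open>A real \<open>SUP\<close> is informative only for a family bounded above;
  \<open>hurwitz_freq_bound\<close> supplies the bound.\<close>

lemma hinf_norm_le_iff:
  fixes A :: "real^'n^'n" and B :: "real^'m^'n"
  assumes hur: "hurwitz (A + B ** K)" and inv: "Bw ** G = mat 1" "G ** Bw = mat 1" and "0 \<le> \<gamma>"
  shows "hinf_norm A B Bw Qh Rh K \<le> \<gamma> \<longleftrightarrow> freq_bound (A + B ** K) G (weight Qh Rh K) \<gamma>"
proof -
  let ?f = "\<lambda>\<omega>. onorm (\<lambda>x. Tinf A B Bw Qh Rh K (\<i> * complex_of_real \<omega>) *v x)"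
  obtain \<gamma>0 where "0 \<le> \<gamma>0" "freq_bound (A + B ** K) G (weight Qh Rh K) \<gamma>0"
    using hurwitz_freq_bound[OF hur inv(1)] by blast
  then have "\<forall>\<omega>. ?f \<omega> \<le> \<gamma>0"
    using onorm_Tinf_le_iff[OF hur inv] by blast
  then have "bdd_above (range ?f)"
    by (intro bdd_aboveI2[of _ _ \<gamma>0]) blast
  then have "hinf_norm A B Bw Qh Rh K \<le> \<gamma> \<longleftrightarrow> (\<forall>\<omega>. ?f \<omega> \<le> \<gamma>)"
    unfolding hinf_norm_def by (subst cSUP_le_iff) simp_all
  then show ?thesis
    using onorm_Tinf_le_iff[OF hur inv \<open>0 \<le> \<gamma>\<close>] by simp
qed

text \<open>Strictness survives the supremum since \<open>riccati_imp_freq_bound\<close> returns one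
  level below \<gamma> for all frequencies.\<close>

lemma hinf_norm_less_iff_riccati:
  fixes A :: "real^'n^'n" and B :: "real^'m^'n"
  assumes inv: "Bw ** G = mat 1" "G ** Bw = mat 1" and Qh: "inj ((*v) Qh)" and "0 < \<gamma>"
  shows "hurwitz (A + B ** K) \<and> hinf_norm A B Bw Qh Rh K < \<gamma>
    \<longleftrightarrow> (\<exists>P. riccati (A + B ** K) Bw (weight Qh Rh K) (1 / \<gamma>\<^sup>2) P)"
proof
  let ?h = "hinf_norm A B Bw Qh Rh K"
  assume *: "hurwitz (A + B ** K) \<and> ?h < \<gamma>"
  \<comment> \<open>The maximum with 0 meets the nonnegativity condition on the level
    directly.\<close>
  then have "freq_bound (A + B ** K) G (weight Qh Rh K) (max 0 ?h)"
    using hinf_norm_le_iff[OF _ inv, of A B K "max 0 ?h" Qh Rh] by simp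
  from riccati_exists[OF _ this _ _ pd_weight[OF Qh] inv, of \<gamma>]
  show "\<exists>P. riccati (A + B ** K) Bw (weight Qh Rh K) (1 / \<gamma>\<^sup>2) P"
    using * \<open>0 < \<gamma>\<close> by simp
next
  let ?h = "hinf_norm A B Bw Qh Rh K"
  assume "\<exists>P. riccati (A + B ** K) Bw (weight Qh Rh K) (1 / \<gamma>\<^sup>2) P"
  then obtain P where P: "riccati (A + B ** K) Bw (weight Qh Rh K) (1 / \<gamma>\<^sup>2) P" by blast
  have hur: "hurwitz (A + B ** K)"
    using P by (rule riccati_hurwitz) (simp_all add: pd_imp_psd pd_weight Qh)
  obtain \<gamma>' where "0 \<le> \<gamma>'" "\<gamma>' < \<gamma>" "freq_bound (A + B ** K) G (weight Qh Rh K) \<gamma>'"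
    using riccati_imp_freq_bound[OF P \<open>0 < \<gamma>\<close> inv(1)] by blast
  then have "?h \<le> \<gamma>'"
    using hinf_norm_le_iff[OF hur inv] by blast
  then show "hurwitz (A + B ** K) \<and> ?h < \<gamma>"
    using hur \<open>\<gamma>' < \<gamma>\<close> by simp
qed

subsection \<open>Convex parametrisation of the controllers\<close>

text \<open>The Riccati form at x = X \<xi>, so that P x = \<xi>. In (X, Y) it is a linear term, a
  constant and two squares of linear maps; raising \<theta> by \<delta> costs exactly \<delta> |V^T
  \<xi>|^2.\<close>

definition lmi_form :: "real^'n^'n \<Rightarrow> real^'m^'n \<Rightarrow> real^'n^'n \<Rightarrow> real^'n^'n \<Rightarrow> real^'m^'m \<Rightarrow> real \<Rightarrow>
    real^'n^'n \<Rightarrow> real^'n^'m \<Rightarrow> real^'n \<Rightarrow> real" where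
  "lmi_form A B V Qh Rh \<theta> X Y \<xi> = 2 * (\<xi> \<bullet> (A *v (X *v \<xi>) + B *v (Y *v \<xi>)))
     + \<theta> * (norm (transpose V *v \<xi>))\<^sup>2 + (norm (Qh *v (X *v \<xi>)))\<^sup>2 + (norm (Rh *v (Y *v \<xi>)))\<^sup>2"

lemma pd_inverse:
  assumes P: "pd P"
  obtains X where "pd X" "X ** P = mat 1" "P ** X = mat 1"
proof -
  have "x = 0" if "P *v x = 0" for x
    using that P by (metis inner_zero_right less_irrefl pd_def)
  then obtain X where X: "X ** P = mat 1"
    by (metis matrix_left_invertible_ker)
  then have PX: "P ** X = mat 1"
    by (simp add: matrix_left_right_inverse)
  have PXv: "P *v (X *v x) = x" for x
    by (simp add: matrix_vector_mul_assoc PX)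
  have "transpose X ** P = mat 1"
    using PX pd_sym[OF P] by (metis matrix_transpose_mul sym_mat_def transpose_mat)
  then have "transpose X = X"
    by (metis PX X matrix_mul_assoc matrix_mul_lid matrix_mul_rid)
  moreover have "0 < x \<bullet> (X *v x)" if "x \<noteq> 0" for x
  proof -
    have "X *v x \<noteq> 0"
      using that PXv[of x] by auto
    then have "0 < (X *v x) \<bullet> (P *v (X *v x))"
      using P by (simp add: pd_def)
    then show ?thesis
      by (simp add: PXv inner_commute)
  qed
  ultimately have "pd X"
    by (simp add: pd_def sym_mat_def)
  with X PX that show thesis by blast
qed

lemma lmi_form_riccati:
  assumes "X ** P = mat 1"
  shows "lmi_form A B V Qh Rh \<theta> X (K ** X) (P *v x)
    = 2 * ((P *v x) \<bullet> ((A + B ** K) *v x)) + \<theta> * (norm (transpose V *v (P *v x)))\<^sup>2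
      + x \<bullet> (weight Qh Rh K *v x)"
proof -
  have "X *v (P *v x) = x"
    by (simp add: matrix_vector_mul_assoc assms)
  then show ?thesis
    by (simp add: lmi_form_def inner_weight matrix_vector_mult_add_rdistrib
        matrix_vector_mul_assoc[symmetric])
qed

lemma lmi_of_riccati:
  assumes P: "riccati (A + B ** K) V (weight Qh Rh K) \<theta> P"
  obtains X where "pd X" "\<And>\<xi>. \<xi> \<noteq> 0 \<Longrightarrow> lmi_form A B V Qh Rh \<theta> X (K ** X) \<xi> < 0"
proof -
  have "pd P" using P by (simp add: riccati_def)
  then obtain X where X: "pd X" "X ** P = mat 1" "P ** X = mat 1"
    by (rule pd_inverse)
  have "lmi_form A B V Qh Rh \<theta> X (K ** X) \<xi> < 0" if "\<xi> \<noteq> 0" for \<xi>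
  proof -
    have \<xi>: "\<xi> = P *v (X *v \<xi>)"
      by (simp add: matrix_vector_mul_assoc X)
    then have "X *v \<xi> \<noteq> 0"
      using that by auto
    then have "lmi_form A B V Qh Rh \<theta> X (K ** X) (P *v (X *v \<xi>)) < 0"
      unfolding lmi_form_riccati[OF X(2)] using P by (simp add: riccati_def)
    then show ?thesis
      using \<xi> by simp
  qed
  with X(1) that show thesis by blast
qed

lemma riccati_of_lmi:
  assumes X: "pd X" and lmi: "\<And>\<xi>. \<xi> \<noteq> 0 \<Longrightarrow> lmi_form A B V Qh Rh \<theta> X Y \<xi> < 0"
  obtains P where "X ** P = mat 1" "riccati (A + B ** (Y ** P)) V (weight Qh Rh (Y ** P)) \<theta> P"
proof -
  obtain P where P: "pd P" "P ** X = mat 1" "X ** P = mat 1"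
    using X by (rule pd_inverse)
  have Y: "Y = (Y ** P) ** X"
    by (simp add: matrix_mul_assoc[symmetric] P)
  have "2 * ((P *v x) \<bullet> ((A + B ** (Y ** P)) *v x)) + \<theta> * (norm (transpose V *v (P *v x)))\<^sup>2
      + x \<bullet> (weight Qh Rh (Y ** P) *v x) < 0" if "x \<noteq> 0" for x
  proof -
    have "P *v x \<noteq> 0"
      using that P(3) by (metis matrix_vector_mul_assoc matrix_vector_mul_lid matrix_vector_mult_0_right)
    then have "lmi_form A B V Qh Rh \<theta> X ((Y ** P) ** X) (P *v x) < 0"
      using lmi Y by metis
    then show ?thesis
      by (simp only: lmi_form_riccati[OF P(3)])
  qed
  with P that show thesis
    by (simp add: riccati_def)
qed

text \<open>The defect is t (1 - t) |x - y|^2.\<close>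

lemma norm_convex_comb_square:
  fixes x y :: "'a::real_inner"
  assumes "0 \<le> t" "t \<le> 1"
  shows "(norm ((1 - t) *\<^sub>R x + t *\<^sub>R y))\<^sup>2 \<le> (1 - t) * (norm x)\<^sup>2 + t * (norm y)\<^sup>2"
proof -
  have "0 \<le> (1 - t) * t * (norm (x - y))\<^sup>2"
    using assms by simp
  also have "\<dots> = (1 - t) * (norm x)\<^sup>2 + t * (norm y)\<^sup>2 - (norm ((1 - t) *\<^sub>R x + t *\<^sub>R y))\<^sup>2"
    unfolding power2_norm_eq_inner
    by (simp add: inner_add_left inner_add_right inner_diff_left inner_diff_right inner_commute
        algebra_simps)
  finally show ?thesis by simp
qed

lemma lmi_form_convex:
  assumes "0 \<le> t" "t \<le> 1"
  shows "lmi_form A B V Qh Rh \<theta> ((1 - t) *\<^sub>R X + t *\<^sub>R X') ((1 - t) *\<^sub>R Y + t *\<^sub>R Y') \<xi>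
    \<le> (1 - t) * lmi_form A B V Qh Rh \<theta> X Y \<xi> + t * lmi_form A B V Qh Rh \<theta> X' Y' \<xi>"
proof -
  have comb: "((1 - t) *\<^sub>R M + t *\<^sub>R M') *v \<xi> = (1 - t) *\<^sub>R (M *v \<xi>) + t *\<^sub>R (M' *v \<xi>)"
    for M M' :: "real^'c^'d" and \<xi>
    by (simp add: matrix_vector_mult_add_rdistrib scaleR_matrix_vector)
  have comb': "M *v ((1 - t) *\<^sub>R x + t *\<^sub>R y) = (1 - t) *\<^sub>R (M *v x) + t *\<^sub>R (M *v y)"
    for M :: "real^'c^'d" and x y
    by (simp add: matrix_vector_right_distrib matrix_vector_mult_scaleR)
  show ?thesis
    using norm_convex_comb_square[OF assms, of "Qh *v (X *v \<xi>)" "Qh *v (X' *v \<xi>)"]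
      norm_convex_comb_square[OF assms, of "Rh *v (Y *v \<xi>)" "Rh *v (Y' *v \<xi>)"]
    unfolding lmi_form_def comb comb' inner_add_right inner_scaleR_right
    by (simp add: algebra_simps)
qed

text \<open>\<open>norm\<close> on matrices is the Frobenius norm; an operator bound, tested on
  basis vectors, controls every entry.\<close>

lemma norm_matrix_le_entrywise:
  fixes M :: "real^'n^'m" and d :: real
  assumes "\<And>x. norm (M *v x) \<le> d * norm x"
  shows "norm M \<le> CARD('m) * CARD('n) * d"
proof -
  have "norm M \<le> (\<Sum>i\<in>UNIV. norm (M $ i))"
    unfolding norm_vec_def[of M] by (rule L2_set_le_sum) simp
  also have "\<dots> \<le> (\<Sum>i\<in>UNIV. \<Sum>j\<in>UNIV. \<bar>M $ i $ j\<bar>)"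
    by (intro sum_mono norm_le_l1_cart)
  also have "\<dots> \<le> (\<Sum>i\<in>(UNIV :: 'm set). \<Sum>j\<in>(UNIV :: 'n set). d)"
  proof (intro sum_mono)
    fix i j
    have "\<bar>M $ i $ j\<bar> = \<bar>(M *v axis j 1) $ i\<bar>"
      by (simp add: matrix_vector_mult_basis column_def)
    also have "\<dots> \<le> norm (M *v axis j 1)"
      by (rule component_le_norm_cart)
    also have "\<dots> \<le> d"
      using assms[of "axis j 1"] by simp
    finally show "\<bar>M $ i $ j\<bar> \<le> d" .
  qed
  finally show ?thesis by simp
qed

subsection \<open>The closure\<close>

lemma hinf_norm_level_in_closure:
  fixes A :: "real^'n^'n" and B :: "real^'m^'n" and K0 K :: "real^'n^'m"
  assumes inv: "Bw ** G = mat 1" "G ** Bw = mat 1" and Qh: "inj ((*v) Qh)" and \<beta>: "0 < \<beta>"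
    and K0: "hurwitz (A + B ** K0)" "hinf_norm A B Bw Qh Rh K0 < \<beta>"
    and K: "hurwitz (A + B ** K)" "hinf_norm A B Bw Qh Rh K \<le> \<beta>"
    and \<kappa>: "0 < \<kappa>" "\<And>x. \<kappa> * (norm x)\<^sup>2 \<le> (norm (transpose Bw *v x))\<^sup>2"
  shows "K \<in> closure {K. hurwitz (A + B ** K) \<and> hinf_norm A B Bw Qh Rh K < \<beta>}"
  unfolding closure_approachable
proof (intro allI impI)
  fix e :: real assume "e > 0"
  note less_iff = hinf_norm_less_iff_riccati[OF inv Qh, where A=A and B=B and Rh=Rh]
  define \<theta> where "\<theta> = 1 / \<beta>\<^sup>2"
  have \<theta>: "\<theta> > 0" using \<beta> by (simp add: \<theta>_def)
  let ?L = "lmi_form A B Bw Qh Rh"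
  obtain P0 where "riccati (A + B ** K0) Bw (weight Qh Rh K0) \<theta> P0"
    using less_iff[OF \<beta>, of K0] K0 by (auto simp: \<theta>_def)
  then obtain X0 where X0: "pd X0" "\<And>\<xi>. \<xi> \<noteq> 0 \<Longrightarrow> ?L \<theta> X0 (K0 ** X0) \<xi> < 0"
    by (rule lmi_of_riccati) blast
  have "\<exists>\<epsilon>>0. \<forall>\<xi>. \<epsilon> * (norm \<xi>)\<^sup>2 \<le> - ?L \<theta> X0 (K0 ** X0) \<xi>"
  proof (rule homogeneous_pos_margin)
    show "continuous_on UNIV (\<lambda>\<xi>. - ?L \<theta> X0 (K0 ** X0) \<xi>)"
      unfolding lmi_form_def by (intro continuous_intros)
    show "- ?L \<theta> X0 (K0 ** X0) (t *\<^sub>R \<xi>) = t\<^sup>2 * - ?L \<theta> X0 (K0 ** X0) \<xi>" for t \<xi>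
      by (simp add: lmi_form_def matrix_vector_mult_scaleR power_mult_distrib inner_add_right
          power2_eq_square[of t] algebra_simps)
  qed (use X0 in simp)
  then obtain \<epsilon> where \<epsilon>: "\<epsilon> > 0" "\<And>\<xi>. \<epsilon> * (norm \<xi>)\<^sup>2 \<le> - ?L \<theta> X0 (K0 ** X0) \<xi>"
    by blast
  obtain v where v: "0 < v" "\<And>x. norm (transpose Bw *v x) \<le> v * norm x"
    using matrix_vector_pos_bounded[of "transpose Bw"] by blast
  let ?D = "K0 ** X0 - K ** X0"
  obtain d where d: "0 < d" "\<And>x. norm (?D *v x) \<le> d * norm x"
    using matrix_vector_pos_bounded[of ?D] by blast
  obtain bB where bB: "0 < bB" "\<And>x. norm (B *v x) \<le> bB * norm x"
    using matrix_vector_pos_bounded[of B] by blast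
  obtain bA where bA: "0 < bA" "\<And>x. norm ((A + B ** K) *v x) \<le> bA * norm x"
    using matrix_vector_pos_bounded[of "A + B ** K"] by blast
  \<comment> \<open>By \<open>riccati_norm_bound\<close>, c turns |A_K' x| for the new controller K'
    into a bound for |D P x|.\<close>
  define c where "c = 2 * d / (\<theta> * \<kappa>)"
  have c: "c > 0" using d \<theta> \<kappa> by (simp add: c_def)
  define N where "N = real CARD('m) * real CARD('n)"
  have N: "N > 0" by (simp add: N_def)
  \<comment> \<open>The first bound keeps a proper mixture, the second lets the feedback of the
    controller error into itself be absorbed with factor 1/2, and the third brings the final
    estimate 2 t c bA N below e.\<close>
  define t where "t = min (1 / 2) (min (1 / (2 * c * bB)) (e / (4 * N * c * bA)))"
  have t: "0 < t" "t < 1" "t * (c * bB) \<le> 1 / 2" "t * (2 * c * bA) * N < e"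
  proof -
    show "0 < t" "t < 1"
      using c bB bA N \<open>e > 0\<close> by (auto simp: t_def min_less_iff_disj)
    have "t \<le> 1 / (2 * c * bB)" "t \<le> e / (4 * N * c * bA)"
      by (simp_all add: t_def)
    then have "t * (2 * c * bB) \<le> 1" "t * (4 * N * c * bA) \<le> e"
      using c bB bA N by (simp_all add: pos_le_divide_eq)
    then show "t * (c * bB) \<le> 1 / 2" "t * (2 * c * bA) * N < e"
      using \<open>e > 0\<close> by (simp_all add: algebra_simps)
  qed
  \<comment> \<open>Returning from level \<theta> - \<delta> to \<theta> costs at most \<delta> v^2
    |\<xi>|^2, which the margin t \<epsilon> |\<xi>|^2 contributed by K0 must exceed; \<theta> / 2
    keeps \<theta> - \<delta> positive.\<close>
  define \<delta> where "\<delta> = min (\<theta> / 2) (t * \<epsilon> / (2 * v\<^sup>2))"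
  have \<delta>: "0 < \<delta>" "\<delta> < \<theta>" "\<delta> * v\<^sup>2 < t * \<epsilon>"
  proof -
    show "0 < \<delta>" "\<delta> < \<theta>"
      using \<theta> t \<epsilon> v by (auto simp: \<delta>_def min_less_iff_disj)
    have "\<delta> \<le> t * \<epsilon> / (2 * v\<^sup>2)"
      by (simp add: \<delta>_def)
    then have "\<delta> * (2 * v\<^sup>2) \<le> t * \<epsilon>"
      using v by (simp add: pos_le_divide_eq)
    moreover have "0 < \<delta> * v\<^sup>2"
      using v \<open>0 < \<delta>\<close> by simp
    ultimately show "\<delta> * v\<^sup>2 < t * \<epsilon>"
      by simp
  qed
  define \<gamma> where "\<gamma> = 1 / sqrt (\<theta> - \<delta>)"
  have "\<beta> < \<gamma>"
  proof -
    have "sqrt (\<theta> - \<delta>) < sqrt \<theta>"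
      using \<delta> by simp
    also have "sqrt \<theta> = 1 / \<beta>"
      using \<beta> by (simp add: \<theta>_def real_sqrt_divide)
    finally show ?thesis
      using \<beta> \<delta> by (simp add: \<gamma>_def field_simps)
  qed
  then have "0 < \<gamma>" "hinf_norm A B Bw Qh Rh K < \<gamma>"
    using \<beta> K by auto
  moreover have "1 / \<gamma>\<^sup>2 = \<theta> - \<delta>"
    using \<delta> by (simp add: \<gamma>_def power_divide)
  ultimately obtain P1 where "riccati (A + B ** K) Bw (weight Qh Rh K) (\<theta> - \<delta>) P1"
    using less_iff[of \<gamma> K] K by auto
  then obtain X1 where X1: "pd X1" "\<And>\<xi>. \<xi> \<noteq> 0 \<Longrightarrow> ?L (\<theta> - \<delta>) X1 (K ** X1) \<xi> < 0"
    by (rule lmi_of_riccati) blast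
  define X Y where "X = (1 - t) *\<^sub>R X1 + t *\<^sub>R X0" and "Y = (1 - t) *\<^sub>R (K ** X1) + t *\<^sub>R (K0 ** X0)"
  have "pd X"
    using X0(1) X1(1) t unfolding pd_def X_def
    by (simp add: sym_mat_def transpose_add transpose_scalar matrix_vector_mult_add_rdistrib
        scaleR_matrix_vector inner_add_right add_pos_pos)
  moreover have "?L \<theta> X Y \<xi> < 0" if "\<xi> \<noteq> 0" for \<xi>
  proof -
    let ?w = "(norm (transpose Bw *v \<xi>))\<^sup>2"
    have "?w \<le> (v * norm \<xi>)\<^sup>2"
      by (intro power_mono v) simp
    then have "\<delta> * ?w \<le> \<delta> * (v * norm \<xi>)\<^sup>2"
      using \<delta> by (intro mult_left_mono) simp_all
    also have "\<dots> = (\<delta> * v\<^sup>2) * (norm \<xi>)\<^sup>2"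
      by (simp add: power_mult_distrib)
    also have "\<dots> < (t * \<epsilon>) * (norm \<xi>)\<^sup>2"
      using \<delta>(3) that by (intro mult_strict_right_mono) simp_all
    finally have w: "\<delta> * ?w < t * (\<epsilon> * (norm \<xi>)\<^sup>2)"
      by simp
    have "?L \<theta> X1 (K ** X1) \<xi> = ?L (\<theta> - \<delta>) X1 (K ** X1) \<xi> + \<delta> * ?w"
      by (simp add: lmi_form_def algebra_simps)
    then have "?L \<theta> X1 (K ** X1) \<xi> \<le> \<delta> * ?w"
      using X1(2)[OF that] by simp
    then have "(1 - t) * ?L \<theta> X1 (K ** X1) \<xi> \<le> (1 - t) * (\<delta> * ?w)"
      using t by (intro mult_left_mono) simp_all
    also have "\<dots> \<le> \<delta> * ?w"
      using t \<delta> by (intro mult_left_le_one_le) simp_all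
    finally have "(1 - t) * ?L \<theta> X1 (K ** X1) \<xi> < t * (\<epsilon> * (norm \<xi>)\<^sup>2)"
      using w by simp
    moreover have "t * ?L \<theta> X0 (K0 ** X0) \<xi> \<le> t * - (\<epsilon> * (norm \<xi>)\<^sup>2)"
      using \<epsilon>(2)[of \<xi>] t by (intro mult_left_mono) simp_all
    moreover have "?L \<theta> X Y \<xi> \<le> (1 - t) * ?L \<theta> X1 (K ** X1) \<xi> + t * ?L \<theta> X0 (K0 ** X0) \<xi>"
      unfolding X_def Y_def using t by (intro lmi_form_convex) simp_all
    ultimately show ?thesis by simp
  qed
  ultimately obtain P where XP: "X ** P = mat 1"
    and P: "riccati (A + B ** (Y ** P)) Bw (weight Qh Rh (Y ** P)) \<theta> P"
    by (rule riccati_of_lmi) blast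
  let ?K = "Y ** P"
  let ?\<Delta> = "?K - K"
  have "hurwitz (A + B ** ?K) \<and> hinf_norm A B Bw Qh Rh ?K < \<beta>"
    using less_iff[OF \<beta>, of ?K] P by (auto simp: \<theta>_def)
  moreover have "norm ?\<Delta> < e"
  proof -
    \<comment> \<open>The terms with X1 cancel in (Y - K X) P x, so the uncontrolled solution X1
      enters only through P.\<close>
    have \<Delta>v: "?\<Delta> *v x = t *\<^sub>R (?D *v (P *v x))" for x
    proof -
      have "x = X *v (P *v x)"
        by (simp add: matrix_vector_mul_assoc XP)
      then have "?\<Delta> *v x = Y *v (P *v x) - K *v (X *v (P *v x))"
        by (metis matrix_vector_mult_diff_rdistrib matrix_vector_mul_assoc)
      then show ?thesis
        by (simp add: X_def Y_def matrix_vector_mult_add_rdistrib matrix_vector_mult_diff_rdistrib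
            scaleR_matrix_vector matrix_vector_right_distrib matrix_vector_mult_scaleR
            matrix_vector_mul_assoc[symmetric] scaleR_diff_right)
    qed
    \<comment> \<open>The bound on P x involves the new closed loop matrix, which contains
      \<open>?\<Delta>\<close> itself; the estimate closes because t c bB is at most 1/2.\<close>
    have "norm (?\<Delta> *v x) \<le> (t * (2 * c * bA)) * norm x" for x
    proof -
      have "\<theta> * \<kappa> * norm (P *v x) \<le> 2 * norm ((A + B ** ?K) *v x)"
        using P by (rule riccati_norm_bound) (use \<theta> \<kappa> in \<open>auto intro: pd_imp_psd pd_weight[OF Qh]\<close>)
      then have "norm (P *v x) \<le> 2 * norm ((A + B ** ?K) *v x) / (\<theta> * \<kappa>)"
        using \<theta> \<kappa> by (simp add: pos_le_divide_eq mult.commute)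
      then have "d * norm (P *v x) \<le> d * (2 * norm ((A + B ** ?K) *v x) / (\<theta> * \<kappa>))"
        using d(1) by (intro mult_left_mono) simp_all
      also have "\<dots> = c * norm ((A + B ** ?K) *v x)"
        by (simp add: c_def)
      finally have "norm (?D *v (P *v x)) \<le> c * norm ((A + B ** ?K) *v x)"
        using d(2)[of "P *v x"] by linarith
      also have "(A + B ** ?K) *v x = (A + B ** K) *v x + B *v (?\<Delta> *v x)"
        by (simp add: matrix_vector_mult_add_rdistrib matrix_vector_mult_diff_rdistrib
            matrix_vector_mult_diff_distrib matrix_vector_mul_assoc matrix_mul_assoc)
      also have "c * norm ((A + B ** K) *v x + B *v (?\<Delta> *v x)) \<le> c * (bA * norm x + bB * norm (?\<Delta> *v x))"
        using c bA(2)[of x] bB(2)[of "?\<Delta> *v x"]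
        by (intro mult_left_mono order_trans[OF norm_triangle_ineq]) simp_all
      finally have "norm (?\<Delta> *v x) \<le> t * (c * (bA * norm x + bB * norm (?\<Delta> *v x)))"
        unfolding \<Delta>v[of x] norm_scaleR using t(1) by (simp add: mult_left_mono)
      also have "\<dots> = t * (c * bA) * norm x + t * (c * bB) * norm (?\<Delta> *v x)"
        by (simp add: algebra_simps)
      also have "\<dots> \<le> t * (c * bA) * norm x + 1 / 2 * norm (?\<Delta> *v x)"
        using t(3) by (intro add_left_mono mult_right_mono) simp_all
      finally show ?thesis by simp
    qed
    from norm_matrix_le_entrywise[OF this] have "norm ?\<Delta> \<le> N * (t * (2 * c * bA))"
      by (simp add: N_def)
    also have "\<dots> < e"
      using t(4) by (simp add: mult.commute)
    finally show ?thesis .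
  qed
  ultimately show "\<exists>K'\<in>{K. hurwitz (A + B ** K) \<and> hinf_norm A B Bw Qh Rh K < \<beta>}. dist K' K < e"
    by (auto simp: dist_norm)
qed

lemma tendsto_matrix_vector [tendsto_intros]:
  fixes f :: "'a \<Rightarrow> real^'n^'m"
  assumes "(f \<longlongrightarrow> M) F"
  shows "((\<lambda>k. f k *v x) \<longlongrightarrow> M *v x) F"
proof (rule bounded_linear.tendsto[OF _ assms])
  have "linear (\<lambda>M :: real^'n^'m. M *v x)"
    by (rule linearI) (simp_all add: matrix_vector_mult_add_rdistrib scaleR_matrix_vector)
  then show "bounded_linear (\<lambda>M :: real^'n^'m. M *v x)"
    by (simp add: linear_conv_bounded_linear)
qed

text \<open>A limit of Hurwitz matrices may a priori have eigenvalues on the imaginary axis. The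
  solutions \<open>P n\<close> need not converge, but they are bounded on each fixed vector, and an
  eigenpair a, b with \<alpha> at least 0 would force |Qh a|^2 + |Qh b|^2 to be at most 0 in the
  limit. The norm bound then passes to the limit one frequency at a time.\<close>

lemma closure_subset_hinf_norm_level:
  fixes A :: "real^'n^'n" and B :: "real^'m^'n" and K :: "real^'n^'m"
  assumes inv: "Bw ** G = mat 1" "G ** Bw = mat 1" and Qh: "inj ((*v) Qh)" and \<beta>: "0 < \<beta>"
    and \<kappa>: "0 < \<kappa>" "\<And>x. \<kappa> * (norm x)\<^sup>2 \<le> (norm (transpose Bw *v x))\<^sup>2"
    and K: "K \<in> closure {K. hurwitz (A + B ** K) \<and> hinf_norm A B Bw Qh Rh K < \<beta>}"
  shows "hurwitz (A + B ** K) \<and> hinf_norm A B Bw Qh Rh K \<le> \<beta>"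
proof -
  obtain Kn where Kn: "\<And>n. hurwitz (A + B ** Kn n)" "\<And>n. hinf_norm A B Bw Qh Rh (Kn n) < \<beta>"
    and lim: "Kn \<longlonglongrightarrow> K"
    using K unfolding closure_sequential by blast
  have Qh0: "Qh *v x = 0 \<Longrightarrow> x = 0" for x
    using injD[OF Qh, of x 0] by simp
  have AB: "(A + B ** L) *v x = A *v x + B *v (L *v x)" for L x
    by (simp add: matrix_vector_mult_add_rdistrib matrix_vector_mul_assoc)
  define \<theta> where "\<theta> = 1 / \<beta>\<^sup>2"
  have \<theta>: "\<theta> > 0" using \<beta> by (simp add: \<theta>_def)
  have "\<exists>P. riccati (A + B ** Kn n) Bw (weight Qh Rh (Kn n)) \<theta> P" for n
    using hinf_norm_less_iff_riccati[OF inv Qh \<beta>, where A=A and B=B and Rh=Rh and K="Kn n"] Kn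
    by (auto simp: \<theta>_def)
  then obtain P where P: "\<And>n. riccati (A + B ** Kn n) Bw (weight Qh Rh (Kn n)) \<theta> (P n)"
    by metis
  have hur: "hurwitz (A + B ** K)"
    unfolding hurwitz_iff_eigenpair
  proof (intro allI impI)
    fix a b \<alpha> \<omega>
    assume "(a \<noteq> 0 \<or> b \<noteq> 0) \<and> (A + B ** K) *v a = \<alpha> *\<^sub>R a - \<omega> *\<^sub>R b \<and>
      (A + B ** K) *v b = \<omega> *\<^sub>R a + \<alpha> *\<^sub>R b"
    then have ne: "a \<noteq> 0 \<or> b \<noteq> 0" and eig: "(A + B ** K) *v a = \<alpha> *\<^sub>R a - \<omega> *\<^sub>R b"
      "(A + B ** K) *v b = \<omega> *\<^sub>R a + \<alpha> *\<^sub>R b"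
      by auto
    show "\<alpha> < 0"
    proof (rule ccontr)
      assume "\<not> \<alpha> < 0"
      let ?A = "\<lambda>n. A + B ** Kn n"
      \<comment> \<open>The residual of the limit eigenpair in the approximating closed
        loops.\<close>
      define r where "r n x = ?A n *v x - (A + B ** K) *v x" for n x
      define q where "q = (norm (Qh *v a))\<^sup>2 + (norm (Qh *v b))\<^sup>2"
      \<comment> \<open>A bound for |P n x| |r n x| by \<open>riccati_norm_bound\<close>; it tends
        to 0 with the residual.\<close>
      define g where "g n x = 2 / (\<theta> * \<kappa>) * norm (?A n *v x) * norm (r n x)" for n x
      have "q > 0"
        using ne Qh0[of a] Qh0[of b] by (auto simp: q_def sum_power2_gt_zero_iff)
      have Axlim: "(\<lambda>n. ?A n *v x) \<longlonglongrightarrow> (A + B ** K) *v x" for x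
        unfolding AB
        by (intro tendsto_intros bounded_linear.tendsto[OF matrix_vector_mul_bounded_linear] lim)
      then have "(\<lambda>n. r n x) \<longlonglongrightarrow> 0" for x
        unfolding r_def by (simp add: LIM_zero)
      then have glim: "(\<lambda>n. g n x) \<longlonglongrightarrow> 2 / (\<theta> * \<kappa>) * norm ((A + B ** K) *v x) * norm (0 :: real^'n)" for x
        unfolding g_def by (intro tendsto_intros Axlim)
      have diss: "2 * ((P n *v x) \<bullet> (?A n *v x)) + (norm (Qh *v x))\<^sup>2 \<le> 0" for n x
      proof (cases "x = 0")
        case False
        then have "2 * ((P n *v x) \<bullet> (?A n *v x)) + \<theta> * (norm (transpose Bw *v (P n *v x)))\<^sup>2
            + x \<bullet> (weight Qh Rh (Kn n) *v x) < 0"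
          using P[of n] by (simp add: riccati_def)
        moreover have "0 \<le> \<theta> * (norm (transpose Bw *v (P n *v x)))\<^sup>2" "0 \<le> (norm (Rh *v (Kn n *v x)))\<^sup>2"
          using \<theta> by simp_all
        ultimately show ?thesis
          unfolding inner_weight by linarith
      qed simp
      have rP: "- ((P n *v x) \<bullet> r n x) \<le> g n x" for n x
      proof -
        have "\<theta> * \<kappa> * norm (P n *v x) \<le> 2 * norm (?A n *v x)"
          using P by (rule riccati_norm_bound) (use \<theta> \<kappa> in \<open>auto intro: pd_imp_psd pd_weight[OF Qh]\<close>)
        then have "norm (P n *v x) \<le> 2 / (\<theta> * \<kappa>) * norm (?A n *v x)"
          using \<theta> \<kappa> by (simp add: pos_le_divide_eq mult.commute)
        then have "norm (P n *v x) * norm (r n x) \<le> g n x"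
          unfolding g_def by (intro mult_right_mono) simp_all
        then show ?thesis
          using norm_cauchy_schwarz[of "- (P n *v x)" "r n x"] by simp
      qed
      \<comment> \<open>As \<alpha> is assumed nonnegative, the exact eigenpair contributes a
        nonnegative Lyapunov term, so the residual alone has to outweigh the fixed dissipation
        q.\<close>
      have "q \<le> 2 * (g n a + g n b)" for n
      proof -
        have pd: "pd (P n)" using P by (simp add: riccati_def)
        have "(P n *v a) \<bullet> (?A n *v a) + (P n *v b) \<bullet> (?A n *v b)
            = \<alpha> * (a \<bullet> (P n *v a) + b \<bullet> (P n *v b)) + ((P n *v a) \<bullet> r n a + (P n *v b) \<bullet> r n b)"
        proof -
          have dec: "?A n *v a = \<alpha> *\<^sub>R a - \<omega> *\<^sub>R b + r n a" "?A n *v b = \<omega> *\<^sub>R a + \<alpha> *\<^sub>R b + r n b"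
            by (simp_all add: r_def eig)
          show ?thesis
            unfolding dec using sym_mat_inner[OF pd_sym[OF pd], of a b]
            by (simp add: inner_add_right inner_diff_right inner_commute algebra_simps)
        qed
        moreover have "0 \<le> \<alpha> * (a \<bullet> (P n *v a) + b \<bullet> (P n *v b))"
          using \<open>\<not> \<alpha> < 0\<close> psd_nonneg[OF pd_imp_psd[OF pd]] by simp
        ultimately have "(P n *v a) \<bullet> r n a + (P n *v b) \<bullet> r n b
            \<le> (P n *v a) \<bullet> (?A n *v a) + (P n *v b) \<bullet> (?A n *v b)"
          by simp
        then show ?thesis
          using diss[of n a] diss[of n b] rP[of n a] rP[of n b]
          unfolding q_def distrib_left by linarith
      qed
      moreover have "(\<lambda>n. 2 * (g n a + g n b)) \<longlonglongrightarrow> 0"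
        using tendsto_mult_left[OF tendsto_add[OF glim[of a] glim[of b]], of 2] by simp
      ultimately have "q \<le> 0"
        by (intro LIMSEQ_le_const) auto
      with \<open>q > 0\<close> show False by simp
    qed
  qed
  moreover have "freq_bound (A + B ** K) G (weight Qh Rh K) \<beta>"
    unfolding freq_bound_def
  proof (intro allI)
    fix a b :: "real^'n" and \<omega> :: real
    have F: "freq_bound (A + B ** Kn n) G (weight Qh Rh (Kn n)) \<beta>" for n
      using hinf_norm_le_iff[OF Kn(1)[of n] inv, of \<beta> Qh Rh] Kn(2)[of n] \<beta> by simp
    note mat_lim = bounded_linear.tendsto[OF matrix_vector_mul_bounded_linear]
    show "a \<bullet> (weight Qh Rh K *v a) + b \<bullet> (weight Qh Rh K *v b) \<le>
        \<beta>\<^sup>2 * ((norm (G *v (- \<omega> *\<^sub>R b - (A + B ** K) *v a)))\<^sup>2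
          + (norm (G *v (\<omega> *\<^sub>R a - (A + B ** K) *v b)))\<^sup>2)"
    proof (rule LIMSEQ_le)
      show "(\<lambda>n. a \<bullet> (weight Qh Rh (Kn n) *v a) + b \<bullet> (weight Qh Rh (Kn n) *v b))
          \<longlonglongrightarrow> a \<bullet> (weight Qh Rh K *v a) + b \<bullet> (weight Qh Rh K *v b)"
        unfolding inner_weight by (intro tendsto_intros mat_lim lim)
      show "(\<lambda>n. \<beta>\<^sup>2 * ((norm (G *v (- \<omega> *\<^sub>R b - (A + B ** Kn n) *v a)))\<^sup>2
            + (norm (G *v (\<omega> *\<^sub>R a - (A + B ** Kn n) *v b)))\<^sup>2))
          \<longlonglongrightarrow> \<beta>\<^sup>2 * ((norm (G *v (- \<omega> *\<^sub>R b - (A + B ** K) *v a)))\<^sup>2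
            + (norm (G *v (\<omega> *\<^sub>R a - (A + B ** K) *v b)))\<^sup>2)"
        unfolding AB by (intro tendsto_intros mat_lim lim)
    qed (use F in \<open>auto simp: freq_bound_def\<close>)
  qed
  ultimately show ?thesis
    using hinf_norm_le_iff[OF hur inv, of \<beta> Qh Rh] \<beta> by simp
qed

theorem theorem1:
  fixes A :: "real^'n^'n" and B :: "real^'m^'n" and Bw :: "real^'n^'n"
    and Q2 Q2h Qinf Qh :: "real^'n^'n" and R2 Rinf Rh :: "real^'m^'m" and \<beta> :: real
  assumes Q2h: "is_msqrt Q2h Q2" and Qh: "is_msqrt Qh Qinf" and Rh: "is_msqrt Rh Rinf"
    and A2: "psd Q2" "pd (Bw ** transpose Bw)" "pd Qinf" "pd R2" "pd Rinf"
    and A1: "stabilizable A B" "detectable Q2h A"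
      "\<beta> > (INF K\<in>{K::real^'n^'m. hurwitz (A + B ** K)}. hinf_norm A B Bw Qh Rh K)"
    and \<beta>pos: "\<beta> > 0"
  shows "closure {K. hurwitz (A + B ** K) \<and> hinf_norm A B Bw Qh Rh K < \<beta>}
       = {K. hurwitz (A + B ** K) \<and> hinf_norm A B Bw Qh Rh K \<le> \<beta>}"
proof -
  have Bw0: "x = 0" if "transpose Bw *v x = 0" for x
  proof (rule ccontr)
    assume "x \<noteq> 0"
    then have "0 < x \<bullet> ((Bw ** transpose Bw) *v x)"
      using A2(2) by (simp add: pd_def)
    then show False
      using that by (simp add: matrix_vector_mul_assoc[symmetric])
  qed
  \<comment> \<open>A left inverse of the transpose, transposed, is a right inverse of
    \<open>Bw\<close>, and for a square matrix it is two-sided.\<close>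
  then obtain G' where G': "G' ** transpose Bw = mat 1"
    by (metis matrix_left_invertible_ker)
  define G where "G = transpose G'"
  have inv: "Bw ** G = mat 1"
    using arg_cong[OF G', of transpose] by (simp add: G_def matrix_transpose_mul)
  then have inv': "G ** Bw = mat 1"
    by (simp add: matrix_left_right_inverse)
  have Qh0: "x = 0" if "Qh *v x = 0" for x
  proof (rule ccontr)
    assume "x \<noteq> 0"
    then have "0 < x \<bullet> ((Qh ** Qh) *v x)"
      using A2(3) Qh by (simp add: pd_def is_msqrt_def)
    then show False
      using that by (simp add: matrix_vector_mul_assoc[symmetric])
  qed
  have Qh_inj: "inj ((*v) Qh)"
  proof (rule injI)
    show "x = y" if "Qh *v x = Qh *v y" for x y
      using Qh0[of "x - y"] that by (simp add: matrix_vector_mult_diff_distrib)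
  qed
  have "\<exists>\<kappa>>0. \<forall>x. \<kappa> * (norm x)\<^sup>2 \<le> (norm (transpose Bw *v x))\<^sup>2"
    by (rule homogeneous_pos_margin)
      (use Bw0 in \<open>auto intro!: continuous_intros simp: matrix_vector_mult_scaleR power_mult_distrib\<close>)
  then obtain \<kappa> where \<kappa>: "0 < \<kappa>" "\<And>x. \<kappa> * (norm x)\<^sup>2 \<le> (norm (transpose Bw *v x))\<^sup>2"
    by blast
  \<comment> \<open>Stabilizability makes the infimum range over a nonempty set, so \<beta> above it
    yields a controller K0 with norm strictly below \<beta>, the one to be mixed in.\<close>
  have "{K :: real^'n^'m. hurwitz (A + B ** K)} \<noteq> {}"
    using A1(1) by (auto simp: stabilizable_def)
  then obtain K0 :: "real^'n^'m" where K0: "hurwitz (A + B ** K0)" "hinf_norm A B Bw Qh Rh K0 < \<beta>"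
    using cInf_lessD[OF _ A1(3)] by auto
  show ?thesis
  proof (intro equalityI subsetI CollectI)
    fix K :: "real^'n^'m"
    show "hurwitz (A + B ** K) \<and> hinf_norm A B Bw Qh Rh K \<le> \<beta>"
      if "K \<in> closure {K. hurwitz (A + B ** K) \<and> hinf_norm A B Bw Qh Rh K < \<beta>}"
      using closure_subset_hinf_norm_level[OF inv inv' Qh_inj \<beta>pos \<kappa> that] .
    show "K \<in> closure {K. hurwitz (A + B ** K) \<and> hinf_norm A B Bw Qh Rh K < \<beta>}"
      if "K \<in> {K. hurwitz (A + B ** K) \<and> hinf_norm A B Bw Qh Rh K \<le> \<beta>}"
      using hinf_norm_level_in_closure[OF inv inv' Qh_inj \<beta>pos K0 _ _ \<kappa>] that by blast
  qed
qed

end
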